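(* Let $\mathbb{K}$ be a field of characteristic zero. If $\mathcal{A}$ is a divisionally free line arrangement in $\mathbf{P}^2_{\mathbb{K}}$, then $n_2(\mathcal{A})>0$.
   Context: A line arrangement $\mathcal{A}$ in $\mathbf{P}^2_{\mathbb{K}}$ is a finite set of lines (equivalently, $2$-dimensional linear subspaces of $\mathbb{K}^3$); standing assumption: the lines of $\mathcal{A}$ do not all pass through one common point. $L_2(\mathcal{A})$ is the set of points that are intersections of at least two lines of $\mathcal{A}$; for $q\in L_2(\mathcal{A})$, $\mu(q)=|\{H\in\mathcal{A}\mid q\in H\}|-1$; $q$ is a double point if $\mu(q)=1$, and $n_2(\mathcal{A})$ is the number of double points. The characteristic polynomial is $\chi_0(\mathcal{A};t)=t^2-(|\mathcal{A}|-1)t+\sum_{q\in L_2(\mathcal{A})}\mu(q)-|\mathcal{A}|+1$. For $H\in\mathcal{A}$, $\mathcal{A}^H=\{q\in L_2(\mathcal{A})\mid q\in H\}$. $\mathcal{A}$ is divisionally free if there is $H\in\mathcal{A}$ with $\chi_0(\mathcal{A};|\mathcal{A}^H|-1)=0$. *)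

theory Defs
  imports "HOL-Analysis.Cartesian_Space" "HOL-Computational_Algebra.Polynomial"
begin

text \<open>
  Points and lines of the projective plane over \<open>'k\<close> are the linear subspaces of \<open>'k^3\<close> of
  dimension 1 and 2, so that incidence of a point with a line is inclusion.
\<close>

definition proj_point :: "('k::field ^ 3) set \<Rightarrow> bool" where
  "proj_point q \<longleftrightarrow> vec.subspace q \<and> vec.dim q = 1"

definition proj_line :: "('k::field ^ 3) set \<Rightarrow> bool" where
  "proj_line H \<longleftrightarrow> vec.subspace H \<and> vec.dim H = 2"

definition line_arrangement :: "('k::field ^ 3) set set \<Rightarrow> bool" where
  "line_arrangement A \<longleftrightarrow>
     finite A \<and> (\<forall>H\<in>A. proj_line H) \<and> \<not> (\<exists>p. proj_point p \<and> (\<forall>H\<in>A. p \<subseteq> H))"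

definition L2 :: "('k::field ^ 3) set set \<Rightarrow> ('k ^ 3) set set" where
  "L2 A = {q. proj_point q \<and> (\<exists>H1\<in>A. \<exists>H2\<in>A. H1 \<noteq> H2 \<and> q = H1 \<inter> H2)}"

definition mu :: "('k::field ^ 3) set set \<Rightarrow> ('k ^ 3) set \<Rightarrow> int" where
  "mu A q = int (card {H \<in> A. q \<subseteq> H}) - 1"

definition n2 :: "('k::field ^ 3) set set \<Rightarrow> nat" where
  "n2 A = card {q \<in> L2 A. mu A q = 1}"

text \<open>Coefficients are listed from the constant term upwards.\<close>

definition chi0 :: "('k::field ^ 3) set set \<Rightarrow> int poly" where
  "chi0 A = [: (\<Sum>q\<in>L2 A. mu A q) - int (card A) + 1, - (int (card A) - 1), 1 :]"

definition restriction :: "('k::field ^ 3) set set \<Rightarrow> ('k ^ 3) set \<Rightarrow> ('k ^ 3) set set" where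
  "restriction A H = {q \<in> L2 A. q \<subseteq> H}"

definition divisionally_free :: "('k::field ^ 3) set set \<Rightarrow> bool" where
  "divisionally_free A \<longleftrightarrow> (\<exists>H\<in>A. poly (chi0 A) (int (card (restriction A H)) - 1) = 0)"

end

theory Submission
  imports Defs
begin

text \<open>
  Put \<open>H\<close> at infinity, so that the other \<open>N = |A| - 1\<close> lines become \<open>y = c x + b\<close> with \<open>h = |A\<^sup>H|\<close>
  different slopes. If there is no double point on \<open>H\<close>, every slope occurs at least twice, and
  divisional freeness says that \<open>\<Sum> (r\<^sub>q - 1) = (h - 1) (N + 1 - h)\<close>, where \<open>q\<close> runs over the affine
  multiple points and \<open>r\<^sub>q\<close> is the number of lines through \<open>q\<close>. This contradicts the bound
  \<open>\<Sum> (r\<^sub>q - 1) \<ge> h (N - h)\<close>, which comes from two estimates of the dimension of the space of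
  polynomial vector fields of degree less than \<open>N\<close> that are tangent to all affine lines. From below, the
  tangency conditions are counted line by line, each multiple point making some of them redundant.
  From above, the top degree part of such a field lies in the module of the Ziegler multirestriction,
  whose exponents \<open>e\<^sub>1 \<le> e\<^sub>2\<close> satisfy \<open>e\<^sub>1 + e\<^sub>2 \<ge> N\<close> by Saito's criterion and, since all
  multiplicities are at least 2 and the characteristic is zero, also \<open>e\<^sub>1 \<ge> h\<close>.
\<close>

section \<open>Counting linear conditions\<close>

locale scaled_space = vector_space scale
  for scale :: "'a::field \<Rightarrow> 'b::ab_group_add \<Rightarrow> 'b"  (infixr "\<cdot>" 75)
begin

text \<open>Bounds the dimension by a finite spanning set. \<open>dim\<close> is 0 on
  infinite-dimensional spaces, so an inequality for \<open>dim\<close> would not force finite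
  dimension.\<close>

definition dim_le :: "'b set \<Rightarrow> nat \<Rightarrow> bool" where
  "dim_le U n \<longleftrightarrow> (\<exists>T. finite T \<and> card T \<le> n \<and> U \<subseteq> span T)"

lemma dim_le_zero: "dim_le {0} 0"
  unfolding dim_le_def by (intro exI[of _ "{}"]) auto

lemma dim_le_mono: "dim_le U m \<Longrightarrow> U' \<subseteq> U \<Longrightarrow> m \<le> n \<Longrightarrow> dim_le U' n"
  unfolding dim_le_def by (meson order_trans)

text \<open>One linear condition costs at most one dimension: if \<open>\<phi>\<close> is nonzero at
  some \<open>v\<close> in \<open>U\<close>, subtracting a multiple of \<open>v\<close> moves any
  vector of \<open>U\<close> into the kernel.\<close>

lemma dim_le_functional:
  assumes "subspace U"
    and add: "\<And>u v. \<phi> (u + v) = \<phi> u + \<phi> v"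
    and scale: "\<And>a u. \<phi> (a \<cdot> u) = a * \<phi> u"
    and ker: "dim_le {u \<in> U. \<phi> u = 0} n"
  shows "dim_le U (Suc n)"
proof (cases "\<forall>u\<in>U. \<phi> u = 0")
  case True
  then have "{u \<in> U. \<phi> u = 0} = U" by auto
  with ker show ?thesis by (auto intro: dim_le_mono)
next
  case False
  then obtain v where v: "v \<in> U" "\<phi> v \<noteq> 0" by auto
  from ker obtain T where T: "finite T" "card T \<le> n" "{u \<in> U. \<phi> u = 0} \<subseteq> span T"
    by (auto simp: dim_le_def)
  have "u \<in> span (insert v T)" if u: "u \<in> U" for u
  proof -
    define a where "a = - (\<phi> u / \<phi> v)"
    have "\<phi> (u + a \<cdot> v) = \<phi> u + a * \<phi> v" by (simp only: add scale)
    then have "\<phi> (u + a \<cdot> v) = 0" using v by (simp add: a_def)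
    moreover have "u + a \<cdot> v \<in> U"
      using u v \<open>subspace U\<close> by (intro subspace_add subspace_scale)
    ultimately have "u + a \<cdot> v \<in> span T" using T(3) by blast
    then have *: "u + a \<cdot> v \<in> span (insert v T)"
      using span_mono[of T "insert v T"] by auto
    have "a \<cdot> v \<in> span (insert v T)" by (intro span_scale span_base) simp
    with * have "(u + a \<cdot> v) - a \<cdot> v \<in> span (insert v T)" by (rule span_diff)
    then show ?thesis by simp
  qed
  moreover have "card (insert v T) \<le> Suc n"
    using T(1,2) by (simp add: card_insert_if)
  ultimately show ?thesis unfolding dim_le_def using T(1) by blast
qed

lemma dim_le_functionals:
  assumes "subspace U"
    and add: "\<And>i u v. \<phi> i (u + v) = \<phi> i u + \<phi> i v"
    and scale: "\<And>i a u. \<phi> i (a \<cdot> u) = a * \<phi> i u"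
    and ker: "dim_le {u \<in> U. \<forall>i<m. \<phi> i u = 0} n"
  shows "dim_le U (n + m)"
  using ker
proof (induction m arbitrary: n)
  case (Suc m)
  let ?U = "{u \<in> U. \<forall>i<m. \<phi> i u = 0}"
  have z: "\<phi> i 0 = 0" for i using scale[of i 0 0] by simp
  have "subspace ?U"
    using \<open>subspace U\<close> by (auto simp: subspace_def add scale z)
  moreover have "{u \<in> ?U. \<phi> m u = 0} = {u \<in> U. \<forall>i<Suc m. \<phi> i u = 0}"
    by (auto simp: less_Suc_eq)
  ultimately have "dim_le ?U (Suc n)"
    using Suc.prems by (intro dim_le_functional[where \<phi> = "\<phi> m"]) (simp_all add: add scale)
  from Suc.IH[OF this] show ?case by simp
qed simp

text \<open>The dual functionals make the \<open>e i\<close> distinct and linearly independent, so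
  every finite spanning set has at least \<open>card I\<close> elements. This turns an upper bound
  \<open>dim_le U n\<close> into a lower bound for \<open>n\<close>.\<close>

lemma dim_le_dual_family:
  assumes "finite I" and "dim_le U n" and "\<And>i. i \<in> I \<Longrightarrow> e i \<in> U"
    and add: "\<And>i u v. \<phi> i (u + v) = \<phi> i u + \<phi> i v"
    and scale: "\<And>i a u. \<phi> i (a \<cdot> u) = a * \<phi> i u"
    and dual: "\<And>i j. i \<in> I \<Longrightarrow> j \<in> I \<Longrightarrow> \<phi> i (e j) = (if i = j then 1 else 0)"
  shows "card I \<le> n"
proof -
  have z: "\<phi> i 0 = 0" for i using scale[of i 0 0] by simp
  have sum: "\<phi> i (\<Sum>x\<in>X. g x) = (\<Sum>x\<in>X. \<phi> i (g x))" for i X and g :: "'c \<Rightarrow> 'b"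
    by (induction X rule: infinite_finite_induct) (simp_all add: z add)
  have inj: "inj_on e I"
    by (rule inj_onI) (metis dual zero_neq_one)
  have "independent (e ` I)"
  proof
    assume "dependent (e ` I)"
    then obtain a i where i: "i \<in> I" "a (e i) \<noteq> 0" and "(\<Sum>v\<in>e ` I. a v \<cdot> v) = 0"
      using \<open>finite I\<close> by (auto simp: dependent_finite)
    then have "(\<Sum>j\<in>I. a (e j) \<cdot> e j) = 0"
      by (simp add: sum.reindex[OF inj])
    then have "0 = \<phi> i (\<Sum>j\<in>I. a (e j) \<cdot> e j)" by (simp add: z)
    also have "\<dots> = (\<Sum>j\<in>I. a (e j) * (if i = j then 1 else 0))"
      unfolding sum by (intro sum.cong) (simp_all add: scale dual i)
    also have "\<dots> = a (e i)"
      using i \<open>finite I\<close> by (simp add: if_distrib[of "\<lambda>x. _ * x"] cong: if_cong)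
    finally show False using i by simp
  qed
  moreover obtain T where T: "finite T" "card T \<le> n" "U \<subseteq> span T"
    using \<open>dim_le U n\<close> by (auto simp: dim_le_def)
  moreover have "e ` I \<subseteq> span T" using assms(3) T(3) by auto
  ultimately have "card (e ` I) \<le> card T" using independent_span_bound by blast
  then show ?thesis using T(2) card_image[OF inj] by simp
qed

end

section \<open>Divisibility by products of linear factors\<close>

lemma prod_linear_powers_dvd:
  fixes p :: "'a::idom poly"
  assumes "finite X" "\<And>x. x \<in> X \<Longrightarrow> [:-x, 1:] ^ m x dvd p"
  shows "(\<Prod>x\<in>X. [:-x, 1:] ^ m x) dvd p"
  using assms
proof (induction X arbitrary: p rule: finite_induct)
  case (insert a X)
  obtain q where q: "p = [:-a, 1:] ^ m a * q" using insert.prems[of a] by auto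
  have "[:-x, 1:] ^ m x dvd q" if x: "x \<in> X" for x
  proof (cases "q = 0")
    case False
    then have "p \<noteq> 0" using q by simp
    \<comment> \<open>The factor at \<open>a\<close> adds nothing to the order of vanishing at
      \<open>x\<close>, so \<open>q\<close> inherits the full order of \<open>p\<close>
      there.\<close>
    have "order x ([:-a, 1:] ^ m a) = 0"
      using x insert.hyps by (intro order_0I) auto
    moreover have "order x p = order x ([:-a, 1:] ^ m a) + order x q"
      unfolding q using \<open>p \<noteq> 0\<close> q by (intro order_mult) simp
    moreover have "m x \<le> order x p"
      using insert.prems[of x] x \<open>p \<noteq> 0\<close> order_divides by blast
    ultimately show ?thesis by (simp add: order_divides)
  qed simp
  then have "(\<Prod>x\<in>X. [:-x, 1:] ^ m x) dvd q" by (rule insert.IH)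
  then show ?case using insert.hyps q by (simp add: mult_dvd_mono)
qed simp

lemma degree_prod_linear_powers:
  "degree (\<Prod>x\<in>X. [:-x, 1:] ^ m x) = (\<Sum>x\<in>X. m x)" for m :: "'a::idom \<Rightarrow> nat"
  by (subst degree_prod_eq_sum_degree) (simp_all add: degree_power_eq)

section \<open>Total degree and top-degree form of polynomials in two variables\<close>

text \<open>A polynomial in \<open>x\<close> and \<open>y\<close> is a polynomial in \<open>y\<close> with coefficients in \<open>k[x]\<close>, so that
  restricting \<open>p\<close> to the line \<open>y = c x + b\<close> is \<^term>\<open>poly p [:b, c:]\<close>.\<close>

definition tdeg_less :: "nat \<Rightarrow> 'a::zero poly poly \<Rightarrow> bool" where
  "tdeg_less n p \<longleftrightarrow> (\<forall>i j. n \<le> i + j \<longrightarrow> coeff (coeff p j) i = 0)"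

text \<open>The homogeneous part of degree \<open>n - 1\<close> with \<open>x\<close> set to 1: the
  coefficient of \<open>x^(n-1-j) y^j\<close> becomes that of \<open>t^j\<close> for a single
  variable \<open>t\<close>.\<close>

definition top_form :: "nat \<Rightarrow> 'a::comm_monoid_add poly poly \<Rightarrow> 'a poly" where
  "top_form n p = (\<Sum>j<n. monom (coeff (coeff p j) (n - 1 - j)) j)"

lemma coeff_top_form: "coeff (top_form n p) j = (if j < n then coeff (coeff p j) (n - 1 - j) else 0)"
  by (simp add: top_form_def coeff_sum)

text \<open>Because the degree bound is strict, \<open>n = 0\<close> singles out the zero
  polynomial, so truncated differences such as \<open>n - card B\<close> remain meaningful
  bounds.\<close>

lemma tdeg_less_0: "tdeg_less 0 p \<longleftrightarrow> p = 0"
  by (auto simp: tdeg_less_def poly_eq_iff)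

lemma tdeg_less_Suc: "tdeg_less n p \<longleftrightarrow> tdeg_less (Suc n) p \<and> top_form (Suc n) p = 0"
proof
  assume "tdeg_less n p"
  then show "tdeg_less (Suc n) p \<and> top_form (Suc n) p = 0"
    by (auto simp: tdeg_less_def poly_eq_iff coeff_top_form)
next
  assume *: "tdeg_less (Suc n) p \<and> top_form (Suc n) p = 0"
  show "tdeg_less n p" unfolding tdeg_less_def
  proof (intro allI impI)
    fix i j assume "n \<le> i + j"
    show "coeff (coeff p j) i = 0"
    proof (cases "i + j = n")
      case True
      then have "coeff (top_form (Suc n) p) j = coeff (coeff p j) i"
        by (auto simp: coeff_top_form)
      with * show ?thesis by simp
    next
      case False
      with * \<open>n \<le> i + j\<close> show ?thesis by (simp add: tdeg_less_def)
    qed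
  qed
qed

lemma coeff_linear_mult:
  "coeff ([:b, c:] * r) i = b * coeff r i + (if i = 0 then 0 else c * coeff r (i - 1))"
  for b :: "'a::comm_ring_1"
  by (cases i) simp_all

lemma coeff_line_mult:
  fixes q :: "'a::comm_ring_1 poly poly"
  shows "coeff (coeff ([:- [:b, c:], 1:] * q) j) i =
    (if j = 0 then 0 else coeff (coeff q (j - 1)) i)
    - b * coeff (coeff q j) i - (if i = 0 then 0 else c * coeff (coeff q j) (i - 1))"
proof -
  have "coeff ([:- [:b, c:], 1:] * q) j = (if j = 0 then 0 else coeff q (j - 1)) - [:b, c:] * coeff q j"
    by (cases j) (simp_all add: algebra_simps)
  then show ?thesis by (simp only: coeff_diff coeff_linear_mult) (simp add: algebra_simps)
qed

text \<open>Comparing coefficients determines those of \<open>q\<close> from the highest power of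
  \<open>y\<close> downwards: coefficient \<open>j\<close> of \<open>q\<close> is read off at power
  \<open>j + 1\<close> of the product.\<close>

lemma tdeg_less_line_quotient:
  fixes q :: "'a::comm_ring_1 poly poly"
  assumes "tdeg_less n ([:- [:b, c:], 1:] * q)"
  shows "tdeg_less (n - 1) q"
    and "top_form n ([:- [:b, c:], 1:] * q) = [:-c, 1:] * top_form (n - 1) q"
proof -
  let ?p = "[:- [:b, c:], 1:] * q"
  have *: "coeff (coeff q j) i = 0" if "n - 1 \<le> i + j" for i j
    using that
  proof (induction "Suc (degree q) - j" arbitrary: i j)
    case 0
    then show ?case by (simp add: coeff_eq_0)
  next
    case (Suc d)
    have "coeff (coeff ?p (Suc j)) i = 0"
      using assms Suc.prems unfolding tdeg_less_def by (metis add_Suc_right le_diff_conv Suc_eq_plus1 add.commute)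
    moreover have "coeff (coeff q (Suc j)) i = 0" "i > 0 \<Longrightarrow> coeff (coeff q (Suc j)) (i - 1) = 0"
      using Suc by auto
    ultimately show ?case unfolding coeff_line_mult by (auto split: if_splits)
  qed
  then show "tdeg_less (n - 1) q" by (simp add: tdeg_less_def)
  show "top_form n ?p = [:-c, 1:] * top_form (n - 1) q"
  proof (rule poly_eqI)
    fix j
    have "coeff (coeff q (n - Suc j)) j = 0" if "j < n" using that by (intro *) auto
    then show "coeff (top_form n ?p) j = coeff ([:-c, 1:] * top_form (n - 1) q) j"
      unfolding coeff_top_form coeff_line_mult unfolding coeff_linear_mult coeff_top_form
      by (auto simp: * )
  qed
qed

text \<open>The lines in \<open>B\<close> are parallel, so on one of them the equation of another is
  a nonzero constant. Hence after one factor is split off, the quotient still vanishes on the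
  remaining lines.\<close>

lemma lines_dvd:
  fixes p :: "'a::idom poly poly"
  assumes "finite B" and "tdeg_less n p" and "\<And>b. b \<in> B \<Longrightarrow> poly p [:b, c:] = 0"
  shows "\<exists>q. p = (\<Prod>b\<in>B. [:- [:b, c:], 1:]) * q \<and> tdeg_less (n - card B) q \<and>
    top_form n p = [:-c, 1:] ^ card B * top_form (n - card B) q"
  using assms
proof (induction B arbitrary: p n rule: finite_induct)
  case (insert a B)
  have "[:- [:a, c:], 1:] dvd p" using insert.prems(2)[of a] poly_eq_0_iff_dvd by blast
  then obtain q where q: "p = [:- [:a, c:], 1:] * q" by auto
  have "poly q [:b, c:] = 0" if "b \<in> B" for b
  proof -
    have "0 = ([:b, c:] - [:a, c:]) * poly q [:b, c:]"
    proof -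
      have "poly [:- [:a, c:], 1:] x = x - [:a, c:]" for x by simp
      then show ?thesis using insert.prems(2)[OF insertI2[OF that]] unfolding q poly_mult by metis
    qed
    moreover have "[:b, c:] - [:a, c:] \<noteq> 0" using that insert.hyps by auto
    ultimately show ?thesis by (metis mult_eq_0_iff)
  qed
  with insert.IH[of "n - 1" q] insert.prems(1) obtain r where
    r: "q = (\<Prod>b\<in>B. [:- [:b, c:], 1:]) * r" "tdeg_less (n - 1 - card B) r"
      "top_form (n - 1) q = [:-c, 1:] ^ card B * top_form (n - 1 - card B) r"
    using tdeg_less_line_quotient(1) unfolding q by blast
  have "top_form n p = [:-c, 1:] * top_form (n - 1) q"
    using insert.prems(1) tdeg_less_line_quotient(2) unfolding q by blast
  moreover have "n - 1 - card B = n - card (insert a B)" "card (insert a B) = Suc (card B)"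
    using insert.hyps by simp_all
  ultimately have "top_form n p = [:-c, 1:] ^ card (insert a B) * top_form (n - card (insert a B)) r"
    using r(3) by (simp only: power_Suc mult.assoc)
  moreover have "p = (\<Prod>b\<in>insert a B. [:- [:b, c:], 1:]) * r"
    unfolding q r(1) prod.insert[OF insert.hyps] mult.assoc ..
  moreover have "tdeg_less (n - card (insert a B)) r"
    using insert.hyps r(2) by simp
  ultimately show ?case by blast
qed simp

lemma coeff_restrict_eq_0:
  fixes p :: "'a::idom poly poly"
  assumes "tdeg_less n p" "n \<le> i"
  shows "coeff (poly p [:b, c:]) i = 0"
proof -
  have "coeff (coeff p j * [:b, c:] ^ j) i = 0" for j
  proof (cases "coeff p j = 0")
    case False
    have "degree (coeff p j) + j < n"
      using assms(1) False unfolding tdeg_less_def by (meson leading_coeff_0_iff not_le)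
    moreover have "degree (coeff p j * [:b, c:] ^ j) \<le> degree (coeff p j) + degree [:b, c:] * j"
      by (meson add_left_mono degree_mult_le degree_power_le order_trans)
    moreover have "degree [:b, c:] * j \<le> j" by simp
    ultimately have "degree (coeff p j * [:b, c:] ^ j) < i" using assms(2) by linarith
    then show ?thesis by (rule coeff_eq_0)
  qed simp
  then show ?thesis by (simp add: poly_altdef coeff_sum)
qed

section \<open>Vector fields tangent to a family of affine lines\<close>

text \<open>The pair \<open>(f, g)\<close> stands for the field
  \<open>f d/dx + g d/dy\<close>.\<close>

type_synonym 'a vfield = "'a poly poly \<times> 'a poly poly"

definition vf_scale :: "'a::field \<Rightarrow> 'a vfield \<Rightarrow> 'a vfield" where
  "vf_scale a \<theta> = (smult [:a:] (fst \<theta>), smult [:a:] (snd \<theta>))"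

lemma fst_vf_scale [simp]: "fst (vf_scale a \<theta>) = smult [:a:] (fst \<theta>)"
  and snd_vf_scale [simp]: "snd (vf_scale a \<theta>) = smult [:a:] (snd \<theta>)"
  by (simp_all add: vf_scale_def)

interpretation vf: scaled_space vf_scale
proof -
  have *: "[:a + b:] = [:a:] + [:b:]" "[:a * b:] = [:a:] * [:b:]" for a b :: 'a by simp_all
  show "scaled_space (vf_scale :: 'a \<Rightarrow> 'a vfield \<Rightarrow> _)"
    unfolding scaled_space_def
  proof (unfold_locales, goal_cases)
    case (2 a b \<theta>)
    show ?case by (rule prod_eqI) (simp_all add: * smult_add_left del: add_pCons)
  next
    case (3 a b \<theta>)
    show ?case by (rule prod_eqI) (simp_all add: * del: mult_pCons_left mult_pCons_right)
  qed (auto intro!: prod_eqI simp: smult_add_right simp flip: one_pCons)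
qed

text \<open>A pair \<^term>\<open>(c, b)\<close> stands for the line \<open>y = c x + b\<close>, which a vector field with vanishing
  \<open>normal_part (c, b)\<close> is tangent to.\<close>

definition normal_part :: "'a \<times> 'a \<Rightarrow> 'a::comm_ring_1 vfield \<Rightarrow> 'a poly" where
  "normal_part l \<theta> = poly (snd \<theta>) [:snd l, fst l:] - smult (fst l) (poly (fst \<theta>) [:snd l, fst l:])"

text \<open>The logarithmic derivations of the affine arrangement \<open>S\<close>, cut off at
  coefficient degree less than \<open>n\<close>.\<close>

definition log_fields :: "('a \<times> 'a) set \<Rightarrow> nat \<Rightarrow> 'a::comm_ring_1 vfield set" where
  "log_fields S n =
    {\<theta>. tdeg_less n (fst \<theta>) \<and> tdeg_less n (snd \<theta>) \<and> (\<forall>l\<in>S. normal_part l \<theta> = 0)}"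

definition through :: "('a \<times> 'a) set \<Rightarrow> 'a \<times> 'a \<Rightarrow> ('a::comm_ring_1 \<times> 'a) set" where
  "through S q = {l \<in> S. snd q = fst l * fst q + snd l}"

text \<open>Abscissas of the points where \<open>l\<close> crosses a line of \<open>S\<close> of
  another slope. As \<open>l\<close> is a graph over \<open>x\<close>, counting abscissas counts
  points.\<close>

definition meets :: "'a \<times> 'a \<Rightarrow> ('a \<times> 'a) set \<Rightarrow> 'a::comm_ring_1 set" where
  "meets l S = {x. \<exists>l'\<in>S. fst l' \<noteq> fst l \<and> fst l' * x + snd l' = fst l * x + snd l}"

definition excess :: "('a::comm_ring_1 \<times> 'a) set \<Rightarrow> nat" where
  "excess S = (\<Sum>q\<in>{q. 2 \<le> card (through S q)}. card (through S q) - 1)"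

lemma normal_part_add: "normal_part l (\<theta> + \<eta>) = normal_part l \<theta> + normal_part l \<eta>"
  by (simp add: normal_part_def smult_add_right)

lemma normal_part_scale: "normal_part l (vf_scale a \<theta>) = smult a (normal_part l \<theta>)"
  by (simp add: normal_part_def smult_diff_right mult.commute)

lemma subspace_log_fields: "vf.subspace (log_fields S n)"
proof -
  have "normal_part l 0 = 0" for l :: "'a \<times> 'a" by (simp add: normal_part_def)
  then show ?thesis
    unfolding vf.subspace_def
    by (auto simp: log_fields_def tdeg_less_def normal_part_add normal_part_scale)
qed

text \<open>This is the redundancy at a multiple point. The determinant \<open>P\<close> is
  divisible by the equations of all lines of \<open>S\<close> through the point. On \<open>l\<close>
  each equation becomes a constant multiple of \<open>[:-x, 1:]\<close>, and one factor cancels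
  because \<open>P\<close> restricts to \<open>[:-x, 1:]\<close> times the normal part.\<close>

lemma normal_part_vanishing_order:
  fixes \<theta> :: "'a::field vfield"
  assumes "finite S" "\<theta> \<in> log_fields S n"
  shows "[:-x, 1:] ^ (card (through S (x, fst l * x + snd l)) - 1) dvd normal_part l \<theta>"
proof (cases "card (through S (x, fst l * x + snd l))")
  case (Suc r)
  define y where "y = fst l * x + snd l"
  let ?T = "through S (x, y)"
  let ?pol = "\<lambda>l::'a \<times> 'a. [:snd l, fst l:]"
  \<comment> \<open>Determinant of the radial field at \<open>(x, y)\<close> and
    \<open>\<theta>\<close>; the radial field is tangent to every line through that point.\<close>
  define P where "P = [:[:-x, 1:]:] * snd \<theta> - [:[:-y:], 1:] * fst \<theta>"
  have P: "poly P (?pol l') = [:-x, 1:] * normal_part l' \<theta>" if "y = fst l' * x + snd l'" for l'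
  proof -
    have "[:-y:] + ?pol l' = smult (fst l') [:-x, 1:]" using that by simp
    then have "poly P (?pol l') =
        [:-x, 1:] * poly (snd \<theta>) (?pol l') - smult (fst l') [:-x, 1:] * poly (fst \<theta>) (?pol l')"
      unfolding P_def poly_diff poly_mult by simp
    then show ?thesis by (simp only: normal_part_def algebra_simps mult_smult_left mult_smult_right)
  qed
  have inj: "inj_on ?pol ?T" by (auto intro!: inj_onI prod_eqI)
  have "(\<Prod>z\<in>?pol ` ?T. [:-z, 1:] ^ 1) dvd P"
  proof (rule prod_linear_powers_dvd)
    show "finite (?pol ` ?T)" using assms(1) by (simp add: through_def)
    fix z assume "z \<in> ?pol ` ?T"
    then obtain l' where l': "l' \<in> S" "y = fst l' * x + snd l'" "z = ?pol l'"
      by (auto simp: through_def)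
    then have "poly P z = 0" using P[of l'] assms(2) by (simp add: log_fields_def)
    then show "[:-z, 1:] ^ 1 dvd P" by (simp add: poly_eq_0_iff_dvd)
  qed
  then have "(\<Prod>l'\<in>?T. [:- ?pol l', 1:]) dvd P"
    by (simp add: prod.reindex[OF inj])
  then have "poly (\<Prod>l'\<in>?T. [:- ?pol l', 1:]) (?pol l) dvd poly P (?pol l)"
    by (auto simp: dvd_def)
  moreover have "(\<Prod>l'\<in>?T. [:-x, 1:]) dvd poly (\<Prod>l'\<in>?T. [:- ?pol l', 1:]) (?pol l)"
    unfolding poly_prod
  proof (rule prod_dvd_prod)
    fix l' assume "l' \<in> ?T"
    then have "poly [:- ?pol l', 1:] (?pol l) = [:-x, 1:] * [:fst l - fst l':]"
      by (simp add: through_def y_def algebra_simps)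
    then show "[:-x, 1:] dvd poly [:- ?pol l', 1:] (?pol l)" by (metis dvd_triv_left)
  qed
  ultimately have "(\<Prod>l'\<in>?T. [:-x, 1:]) dvd poly P (?pol l)"
    by (rule dvd_trans[rotated])
  then have "[:-x, 1:] * [:-x, 1:] ^ r dvd [:-x, 1:] * normal_part l \<theta>"
    using Suc P[of l] by (simp only: prod_constant y_def power_Suc)
  then have "[:-x, 1:] ^ r dvd normal_part l \<theta>"
    by (subst (asm) dvd_mult_cancel_left) simp
  then show ?thesis using Suc by simp
qed simp

text \<open>Tangency to all lines of slope \<open>c\<close> concerns one polynomial,
  \<open>snd \<theta> - c fst \<theta>\<close>, restricted to parallel lines, so their equations
  split off together. The claim on top forms is where the Ziegler multiplicities come from.\<close>

lemma log_fields_divides: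
  fixes \<theta> :: "'a::field vfield" and c :: 'a
  assumes "finite S" "\<theta> \<in> log_fields S n"
  defines "m \<equiv> card {b. (c, b) \<in> S}"
  shows "\<exists>q. snd \<theta> - smult [:c:] (fst \<theta>) = (\<Prod>b\<in>{b. (c, b) \<in> S}. [:- [:b, c:], 1:]) * q \<and>
    tdeg_less (n - m) q \<and> top_form n (snd \<theta> - smult [:c:] (fst \<theta>)) = [:-c, 1:] ^ m * top_form (n - m) q"
  unfolding m_def
proof (rule lines_dvd)
  have "{b. (c, b) \<in> S} \<subseteq> snd ` S" by force
  then show "finite {b. (c, b) \<in> S}" using \<open>finite S\<close> finite_surj by blast
  show "tdeg_less n (snd \<theta> - smult [:c:] (fst \<theta>))"
    using assms(2) by (simp add: log_fields_def tdeg_less_def)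
  show "poly (snd \<theta> - smult [:c:] (fst \<theta>)) [:b, c:] = 0" if "b \<in> {b. (c, b) \<in> S}" for b
    using assms(2) that by (auto simp: log_fields_def normal_part_def)
qed

lemma prod_pCons_const: "(\<Prod>x\<in>X. [:f x:]) = [:\<Prod>x\<in>X. f x:]" for f :: "'b \<Rightarrow> 'a::comm_semiring_1"
  by (induction X rule: infinite_finite_induct) (simp_all add: one_pCons mult.commute)

text \<open>The normal part along \<open>l\<close> is the restriction of a polynomial divisible by
  the lines of \<open>S\<close> parallel to \<open>l\<close>. On \<open>l\<close> their equations
  are constants, so each of them lowers the degree bound by one.\<close>

lemma coeff_normal_part_eq_0:
  fixes \<theta> :: "'a::field vfield"
  assumes "finite S" "\<theta> \<in> log_fields S n" "n - card {b. (fst l, b) \<in> S} \<le> i"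
  shows "coeff (normal_part l \<theta>) i = 0"
proof -
  let ?c = "fst l"
  obtain q where q: "snd \<theta> - smult [:?c:] (fst \<theta>) = (\<Prod>b\<in>{b. (?c, b) \<in> S}. [:- [:b, ?c:], 1:]) * q"
    "tdeg_less (n - card {b. (?c, b) \<in> S}) q"
    using log_fields_divides[OF assms(1,2)] by blast
  have "normal_part l \<theta> = poly (snd \<theta> - smult [:?c:] (fst \<theta>)) [:snd l, ?c:]"
    by (simp add: normal_part_def)
  also have "\<dots> = (\<Prod>b\<in>{b. (?c, b) \<in> S}. [:snd l - b:]) * poly q [:snd l, ?c:]"
    unfolding q(1) by (simp add: poly_prod algebra_simps)
  also have "(\<Prod>b\<in>{b. (?c, b) \<in> S}. [:snd l - b:]) = [:\<Prod>b\<in>{b. (?c, b) \<in> S}. snd l - b:]"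
    by (rule prod_pCons_const)
  finally have "coeff (normal_part l \<theta>) i = (\<Prod>b\<in>{b. (?c, b) \<in> S}. snd l - b) * coeff (poly q [:snd l, ?c:]) i"
    by simp
  then show ?thesis using coeff_restrict_eq_0[OF q(2) assms(3)] by simp
qed

section \<open>Intersections of one line with the others\<close>

definition crossing :: "'a \<times> 'a \<Rightarrow> 'a \<times> 'a \<Rightarrow> 'a::field" where
  "crossing l l' = (snd l' - snd l) / (fst l - fst l')"

lemma crossing_iff:
  "fst l' \<noteq> fst l \<Longrightarrow> fst l' * x + snd l' = fst l * x + snd l \<longleftrightarrow> x = crossing l l'"
  by (auto simp: crossing_def field_simps)

lemma finite_multiple_points:
  fixes S :: "('a::field \<times> 'a) set"
  assumes "finite S"
  shows "finite {q. 2 \<le> card (through S q)}"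
proof (rule finite_subset)
  let ?f = "\<lambda>(l, l'). (crossing l l', fst l * crossing l l' + snd l)"
  show "finite (?f ` (S \<times> S))" using assms by simp
  show "{q. 2 \<le> card (through S q)} \<subseteq> ?f ` (S \<times> S)"
  proof
    fix q assume "q \<in> {q. 2 \<le> card (through S q)}"
    then obtain l l' where l: "l \<in> through S q" "l' \<in> through S q" "l \<noteq> l'"
      by (metis (no_types, lifting) card_le_Suc0_iff_eq card.infinite mem_Collect_eq not_less_eq_eq
          numeral_2_eq_2 zero_le)
    then have eq: "snd q = fst l * fst q + snd l" "snd q = fst l' * fst q + snd l'"
      by (auto simp: through_def)
    then have "fst l' \<noteq> fst l" using l(3) by (auto intro: prod_eqI)
    then have "fst q = crossing l l'" using eq crossing_iff by metis
    then have "q = ?f (l, l')" using eq by (auto intro: prod_eqI)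
    moreover have "(l, l') \<in> S \<times> S" using l by (simp add: through_def)
    ultimately show "q \<in> ?f ` (S \<times> S)" by (rule image_eqI)
  qed
qed

lemma through_on_line:
  assumes "l \<notin> S"
  shows "through S (x, fst l * x + snd l) = {l' \<in> S. fst l' \<noteq> fst l \<and> x = crossing l l'}"
proof -
  have "fst l * x + snd l = fst l' * x + snd l' \<longleftrightarrow> fst l' \<noteq> fst l \<and> x = crossing l l'"
    if "l' \<in> S" for l'
  proof -
    have "l' \<noteq> l" using that assms by blast
    then show ?thesis using crossing_iff[of l' l x] by (cases "fst l' = fst l") (auto simp: prod_eq_iff)
  qed
  then show ?thesis unfolding through_def by auto
qed

lemma meets_eq_image: "meets l S = crossing l ` {l' \<in> S. fst l' \<noteq> fst l}"
  unfolding meets_def image_def using crossing_iff by blast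

lemma meets_iff:
  fixes l :: "'a::field \<times> 'a"
  assumes "l \<notin> S" "finite S"
  shows "x \<in> meets l S \<longleftrightarrow> 1 \<le> card (through S (x, fst l * x + snd l))"
proof -
  have "finite (through S (x, fst l * x + snd l))" using assms(2) by (simp add: through_def)
  then have "1 \<le> card (through S (x, fst l * x + snd l)) \<longleftrightarrow> through S (x, fst l * x + snd l) \<noteq> {}"
    by (simp add: Suc_le_eq card_gt_0_iff)
  also have "\<dots> \<longleftrightarrow> x \<in> meets l S"
    unfolding through_on_line[OF assms(1)] meets_eq_image by blast
  finally show ?thesis ..
qed

lemma finite_meets: "finite S \<Longrightarrow> finite (meets l S)" for l :: "'a::field \<times> 'a"
  by (simp add: meets_eq_image)

lemma sum_card_meets:
  fixes l :: "'a::field \<times> 'a"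
  assumes "l \<notin> S" "finite S"
  shows "card {b. (fst l, b) \<in> S} + (\<Sum>x\<in>meets l S. card (through S (x, fst l * x + snd l))) = card S"
proof -
  let ?g = "crossing l" and ?S = "{l' \<in> S. fst l' \<noteq> fst l}"
  have "card ?S = (\<Sum>x\<in>?g ` ?S. \<Sum>l'\<in>{l' \<in> ?S. ?g l' = x}. 1)"
    unfolding card_eq_sum using assms(2) by (intro sum.image_gen) simp
  also have "\<dots> = (\<Sum>x\<in>meets l S. card (through S (x, fst l * x + snd l)))"
    unfolding meets_eq_image through_on_line[OF assms(1)] card_eq_sum
    by (intro sum.cong) auto
  finally have "card ?S = (\<Sum>x\<in>meets l S. card (through S (x, fst l * x + snd l)))" .
  moreover have "{l' \<in> S. fst l' = fst l} = Pair (fst l) ` {b. (fst l, b) \<in> S}"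
    by force
  then have "card {l' \<in> S. fst l' = fst l} = card {b. (fst l, b) \<in> S}"
    by (simp add: card_image inj_on_def)
  moreover have "card S = card {l' \<in> S. fst l' = fst l} + card ?S"
    using assms(2) by (subst card_Un_disjoint[symmetric]) (auto intro: arg_cong[of _ _ card])
  ultimately show ?thesis by simp
qed

text \<open>At each point where \<open>l\<close> crosses lines of \<open>S\<close>, one more line
  passes. The summand grows by one there, also where a point on one line only becomes a double
  point.\<close>

lemma excess_insert:
  fixes l :: "'a::field \<times> 'a"
  assumes "l \<notin> S" "finite S"
  shows "excess (insert l S) = excess S + card (meets l S)"
proof -
  let ?r = "\<lambda>q. card (through S q)" and ?X = "{q. 2 \<le> card (through (insert l S) q)}"
  let ?Y = "(\<lambda>x. (x, fst l * x + snd l)) ` meets l S"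
  have fin: "finite (through S q)" for q using assms(2) by (simp add: through_def)
  have ins: "card (through (insert l S) q) = ?r q + (if snd q = fst l * fst q + snd l then 1 else 0)" for q
  proof -
    have "through (insert l S) q = (if snd q = fst l * fst q + snd l then insert l (through S q) else through S q)"
      by (auto simp: through_def)
    moreover have "l \<notin> through S q" using assms(1) by (simp add: through_def)
    ultimately show ?thesis using fin by simp
  qed
  have Y: "q \<in> ?Y \<longleftrightarrow> snd q = fst l * fst q + snd l \<and> 1 \<le> ?r q" for q
    by (cases q) (auto simp: meets_iff[OF assms])
  have X: "finite ?X" using assms(2) by (intro finite_multiple_points) simp
  have YX: "?Y \<subseteq> ?X" using Y ins by fastforce
  have "excess (insert l S) = (\<Sum>q\<in>?X. (?r q - 1) + (if q \<in> ?Y then 1 else 0))"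
    unfolding excess_def Y ins by (intro sum.cong) auto
  also have "\<dots> = (\<Sum>q\<in>?X. ?r q - 1) + card (?X \<inter> ?Y)"
    using X by (simp add: sum.distrib sum.If_cases Int_def)
  also have "?X \<inter> ?Y = ?Y" using YX by blast
  also have "card ?Y = card (meets l S)" by (intro card_image inj_onI) simp
  also have "(\<Sum>q\<in>?X. ?r q - 1) = excess S"
    unfolding excess_def using X by (intro sum.mono_neutral_right) (auto simp: ins)
  finally show ?thesis .
qed

section \<open>Counting tangency conditions line by line\<close>

lemma dim_le_log_fields_insert:
  fixes l :: "'a::field \<times> 'a"
  assumes "l \<notin> S" "finite S" "card S \<le> n" "vf.dim_le (log_fields (insert l S) n) a"
  shows "vf.dim_le (log_fields S n) (a + (n + card (meets l S) - card S))"
proof -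
  let ?r = "\<lambda>x. card (through S (x, fst l * x + snd l))"
  \<comment> \<open>\<open>D\<close> divides the normal part along \<open>l\<close> of every field
    tangent to \<open>S\<close>, so only the quotient has to be made zero. \<open>m\<close> is the
    number of its possible coefficients: the degree bound
    \<open>n - card {b. (fst l, b) \<in> S}\<close> minus \<open>degree D\<close>.\<close>
  define D where "D = (\<Prod>x\<in>meets l S. [:-x, 1:] ^ (?r x - 1))"
  define m where "m = n + card (meets l S) - card S"
  have fin: "finite (meets l S)" using assms(2) by (rule finite_meets)
  have D: "D \<noteq> 0" "degree D = (\<Sum>x\<in>meets l S. ?r x - 1)"
    using fin unfolding D_def degree_prod_linear_powers by simp_all
  \<comment> \<open>Each of these points lies on some line of \<open>S\<close>, so the subtraction
    in \<open>?r x - 1\<close> is exact.\<close>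
  have "(\<Sum>x\<in>meets l S. ?r x) = (\<Sum>x\<in>meets l S. (?r x - 1) + 1)"
    using meets_iff[OF assms(1,2)] by (intro sum.cong) auto
  then have degD: "card {b. (fst l, b) \<in> S} + (degree D + card (meets l S)) = card S"
    using sum_card_meets[OF assms(1,2)] by (simp only: D(2) sum.distrib) simp
  have "{\<theta> \<in> log_fields S n. \<forall>i<m. coeff (normal_part l \<theta> div D) i = 0} \<subseteq> log_fields (insert l S) n"
  proof safe
    fix \<theta> :: "'a vfield" assume \<theta>: "\<theta> \<in> log_fields S n" "\<forall>i<m. coeff (normal_part l \<theta> div D) i = 0"
    have "D dvd normal_part l \<theta>"
      unfolding D_def using fin assms(2) \<theta>(1)
      by (intro prod_linear_powers_dvd normal_part_vanishing_order)
    then obtain q where q: "normal_part l \<theta> = D * q" by auto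
    have "q = 0"
    proof (rule ccontr)
      assume "q \<noteq> 0"
      with D q \<theta>(2) have "m \<le> degree q" by (metis leading_coeff_0_iff nonzero_mult_div_cancel_left not_le)
      then have "n - card {b. (fst l, b) \<in> S} \<le> degree (D * q)"
        using degD \<open>card S \<le> n\<close> D(1) \<open>q \<noteq> 0\<close> unfolding m_def by (simp add: degree_mult_eq)
      then have "lead_coeff (D * q) = 0"
        unfolding q[symmetric] by (rule coeff_normal_part_eq_0[OF assms(2) \<theta>(1)])
      then show False using D(1) \<open>q \<noteq> 0\<close> by simp
    qed
    then show "\<theta> \<in> log_fields (insert l S) n" using q \<theta>(1) by (simp add: log_fields_def)
  qed
  then have "vf.dim_le {\<theta> \<in> log_fields S n. \<forall>i<m. coeff (normal_part l \<theta> div D) i = 0} a"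
    by (rule vf.dim_le_mono[OF assms(4)]) simp
  \<comment> \<open>Division by \<open>D\<close> is linear on all polynomials over a field, so the
    functionals are linear even where \<open>D\<close> does not divide.\<close>
  then show ?thesis unfolding m_def[symmetric]
    by (rule vf.dim_le_functionals
        [where \<phi> = "\<lambda>i \<theta>. coeff (normal_part l \<theta> div D) i", rotated -1])
      (simp_all add: subspace_log_fields normal_part_add normal_part_scale poly_div_add_left div_smult_left)
qed

text \<open>A line joining \<open>k\<close> others costs \<open>n - k\<close> conditions plus one
  for every point in which it crosses them. With \<open>N = card S\<close> this adds up to
  \<open>n N - N (N - 1) / 2 + excess S\<close>, doubled to avoid the division.\<close>

lemma dim_le_log_fields_empty:
  fixes S :: "('a::field \<times> 'a) set"
  assumes "finite S" "card S \<le> n" "vf.dim_le (log_fields S n) a"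
  shows "\<exists>R. vf.dim_le (log_fields {} n :: 'a vfield set) (a + R) \<and>
    2 * int R = 2 * int n * card S - card S * (card S - 1) + 2 * excess S"
  using assms
proof (induction S arbitrary: a rule: finite_induct)
  case empty
  have "through {} q = {}" for q :: "'a \<times> 'a" by (simp add: through_def)
  then show ?case using empty by (intro exI[of _ 0]) (simp add: excess_def)
next
  case (insert l S)
  let ?m = "n + card (meets l S) - card S"
  have "card S \<le> n" using insert by simp
  from insert.IH[OF this dim_le_log_fields_insert[OF insert.hyps(2,1) this insert.prems(2)]]
  obtain R where R: "vf.dim_le (log_fields {} n :: 'a vfield set) (a + ?m + R)"
    "2 * int R = 2 * int n * card S - card S * (card S - 1) + 2 * excess S" by auto
  have "int (card S * (card S - 1)) = int (card S) * (int (card S) - 1)"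
    by (cases "card S") (simp_all add: algebra_simps)
  then have "2 * int (?m + R) = 2 * int n * card (insert l S) - card (insert l S) * (card (insert l S) - 1)
      + 2 * excess (insert l S)"
    using R(2) insert.hyps \<open>card S \<le> n\<close>
    by (simp add: excess_insert algebra_simps of_nat_diff)
  then show ?case using R(1) by (intro exI[of _ "?m + R"]) (simp add: add.assoc)
qed

text \<open>The fields with one component \<open>x^i y^j\<close>, \<open>i + j < n\<close>, and the
  other zero are dual to the coefficient functionals. Each component contributes
  \<open>n (n + 1) / 2\<close> of them.\<close>

lemma dim_le_all_fields:
  assumes "vf.dim_le (log_fields {} n :: 'a::field vfield set) a"
  shows "n * (n + 1) \<le> a"
proof -
  let ?I = "(UNIV :: bool set) \<times> (SIGMA i:{..<n}. {..<n - i})"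
  let ?e = "\<lambda>(s, i, j). if s then (monom (monom (1::'a) i) j, 0) else (0, monom (monom 1 i) j)"
  let ?\<phi> = "\<lambda>(s, i, j) \<theta>. coeff (coeff (if s then fst \<theta> else snd (\<theta> :: 'a vfield)) j) i"
  have "card ?I \<le> a"
  proof (rule vf.dim_le_dual_family[where e = ?e and \<phi> = ?\<phi>, OF _ assms])
    show "?e i \<in> log_fields {} n" if "i \<in> ?I" for i
      using that by (auto simp: log_fields_def tdeg_less_def)
    show "?\<phi> i (?e j) = (if i = j then 1 else 0)" if "i \<in> ?I" "j \<in> ?I" for i j
      by (cases i; cases j) auto
  qed (auto split: prod.splits)
  moreover have "(\<Sum>i<n. n - i) = (\<Sum>i<n. Suc i)"
    by (rule sum.reindex_bij_witness[of _ "\<lambda>i. n - Suc i" "\<lambda>i. n - Suc i"]) auto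
  moreover have "2 * (\<Sum>i<n. Suc i) = n * (n + 1)"
    by (induction n) auto
  ultimately show ?thesis by (simp add: card_cartesian_product)
qed

section \<open>The multirestriction to the line at infinity\<close>

definition multi_fields :: "('a::comm_ring_1 \<Rightarrow> nat) \<Rightarrow> 'a set \<Rightarrow> nat \<Rightarrow> ('a poly \<times> 'a poly) set" where
  "multi_fields m C d = {(F, G). degree F \<le> d \<and> degree G \<le> d \<and>
    (\<forall>c\<in>C. [:-c, 1:] ^ m c dvd G - smult c F)}"

text \<open>Values of these derivations at \<open>x = 0\<close>, \<open>y = 1\<close>, a point on
  none of the lines \<open>y = c x\<close>. The rank of the value set, as \<open>d\<close> grows,
  records the exponents.\<close>

definition leading :: "('a::comm_ring_1 \<Rightarrow> nat) \<Rightarrow> 'a set \<Rightarrow> nat \<Rightarrow> ('a \<times> 'a) set" where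
  "leading m C d = (\<lambda>(F, G). (coeff F d, coeff G d)) ` multi_fields m C d"

lemma top_form_0 [simp]: "top_form n 0 = 0"
  by (simp add: poly_eq_iff coeff_top_form)

lemma top_form_add: "top_form n (p + q) = top_form n p + top_form n q"
  by (simp add: poly_eq_iff coeff_top_form)

lemma top_form_diff: "top_form n (p - q) = top_form n p - top_form n q"
  for p :: "'a::ab_group_add poly poly"
  by (simp add: poly_eq_iff coeff_top_form)

lemma top_form_smult: "top_form n (smult [:a:] p) = smult a (top_form n p)"
  for p :: "'a::comm_ring_1 poly poly"
  by (simp add: poly_eq_iff coeff_top_form)

text \<open>The factorisation of \<open>snd \<theta> - c fst \<theta>\<close> passes to top forms,
  so the top form of a tangent field lies in the multirestriction, where \<open>c\<close> has the
  number of lines of slope \<open>c\<close> as its multiplicity.\<close>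

lemma leading_top_form:
  fixes \<theta> :: "'a::field vfield"
  assumes "finite S" "\<theta> \<in> log_fields S n"
    and F: "\<And>l. d < l \<Longrightarrow> coeff (top_form n (fst \<theta>)) l = 0"
    and G: "\<And>l. d < l \<Longrightarrow> coeff (top_form n (snd \<theta>)) l = 0"
  shows "(coeff (top_form n (fst \<theta>)) d, coeff (top_form n (snd \<theta>)) d)
    \<in> leading (\<lambda>c. card {b. (c, b) \<in> S}) C d"
proof -
  have "[:-c, 1:] ^ card {b. (c, b) \<in> S} dvd top_form n (snd \<theta>) - smult c (top_form n (fst \<theta>))" for c
    using log_fields_divides[OF assms(1,2), of c] by (auto simp: top_form_diff top_form_smult)
  then have "(top_form n (fst \<theta>), top_form n (snd \<theta>)) \<in> multi_fields (\<lambda>c. card {b. (c, b) \<in> S}) C d"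
    using F G by (auto simp: multi_fields_def intro: degree_le)
  then show ?thesis unfolding leading_def by force
qed

text \<open>One half of Saito's criterion: the determinant \<open>F G' - F' G\<close> is divisible
  by every \<open>[:-c, 1:] ^ m c\<close>, and it is nonzero because its coefficient in degree
  \<open>d + d'\<close> is the determinant of the two leading vectors. Comparing degrees gives the
  bound.\<close>

lemma leading_independent:
  fixes x :: "'a::field"
  assumes "finite C" "(x, y) \<in> leading m C d" "(x', y') \<in> leading m C d'" "x * y' \<noteq> x' * y"
  shows "(\<Sum>c\<in>C. m c) \<le> d + d'"
proof -
  obtain F G where 1: "(F, G) \<in> multi_fields m C d" "x = coeff F d" "y = coeff G d"
    using assms(2) by (auto simp: leading_def)
  obtain F' G' where 2: "(F', G') \<in> multi_fields m C d'" "x' = coeff F' d'" "y' = coeff G' d'"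
    using assms(3) by (auto simp: leading_def)
  define D where "D = F * G' - F' * G"
  have coeff_top: "coeff (p * q) (i + j) = coeff p i * coeff q j"
    if "degree p \<le> i" "degree q \<le> j" for p q :: "'a poly" and i j
  proof (cases "degree p = i \<and> degree q = j")
    case True
    then show ?thesis using coeff_mult_degree_sum[of p q] by simp
  next
    case False
    then have "degree p < i \<or> degree q < j" using that by auto
    moreover from this have "degree (p * q) < i + j"
      using degree_mult_le[of p q] that by linarith
    ultimately show ?thesis by (auto simp: coeff_eq_0)
  qed
  have "coeff D (d + d') = x * y' - x' * y"
    using 1 2 coeff_top[of F d G' d'] coeff_top[of F' d' G d]
    by (simp add: D_def multi_fields_def add.commute)
  then have "D \<noteq> 0" using assms(4) by auto
  have "degree D \<le> d + d'"
    unfolding D_def using 1(1) 2(1)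
    by (intro degree_diff_le order_trans[OF degree_mult_le]) (auto simp: multi_fields_def)
  have "[:-c, 1:] ^ m c dvd D" if "c \<in> C" for c
  proof -
    have "D = F * (G' - smult c F') - F' * (G - smult c F)"
      by (simp add: D_def algebra_simps)
    then show ?thesis using 1(1) 2(1) that by (auto simp: multi_fields_def)
  qed
  then have "(\<Prod>c\<in>C. [:-c, 1:] ^ m c) dvd D" using assms(1) by (rule prod_linear_powers_dvd[rotated])
  then show ?thesis
    using dvd_imp_degree_le[OF _ \<open>D \<noteq> 0\<close>] \<open>degree D \<le> d + d'\<close>
    by (fastforce simp: degree_prod_linear_powers)
qed

text \<open>Multiplicity 2 gives \<open>G(c) = c F(c)\<close> and \<open>G'(c) = c F'(c)\<close> at
  \<open>card C\<close> points. By degree the second becomes the identity \<open>G' = t F'\<close>.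
  In characteristic zero its top coefficient lowers the degree of \<open>F\<close>, after which the
  first becomes \<open>G = t F\<close>. Differentiating leaves \<open>F = 0\<close>.\<close>

lemma multi_fields_low_degree:
  fixes C :: "'a::field_char_0 set"
  assumes C: "finite C" "2 \<le> card C" and m: "\<And>c. c \<in> C \<Longrightarrow> 2 \<le> m c"
    and FG: "(F, G) \<in> multi_fields m C d" and d: "d < card C"
  shows "F = 0 \<and> G = 0"
proof -
  let ?h = "card C"
  have degs: "degree F < ?h" "degree G < ?h"
    using FG d by (auto simp: multi_fields_def)
  have zero: "p = 0" if "\<And>c. c \<in> C \<Longrightarrow> poly p c = 0" "degree p < ?h" for p :: "'a poly"
    using that d by (intro poly_eqI_degree[of C]) auto
  have roots: "poly G c = c * poly F c" "poly (pderiv G) c = c * poly (pderiv F) c" if "c \<in> C" for c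
  proof -
    have "[:-c, 1:] ^ 2 dvd G - smult c F"
      using FG m[OF that] that by (auto simp: multi_fields_def dest: power_le_dvd)
    then obtain q where q: "G - smult c F = [:-c, 1:] ^ 2 * q" by auto
    have "poly (G - smult c F) c = 0" unfolding q by simp
    then show "poly G c = c * poly F c" by simp
    have "poly (pderiv (G - smult c F)) c = 0"
      unfolding q power2_eq_square pderiv_mult poly_add poly_mult by simp
    then show "poly (pderiv G) c = c * poly (pderiv F) c" by (simp add: pderiv_diff pderiv_smult)
  qed
  have "degree (pCons 0 (pderiv F)) < ?h"
    using degs(1) d by (cases "pderiv F = 0") (auto simp: degree_pderiv pderiv_eq_0_iff)
  moreover have "degree (pderiv G) < ?h" using degs(2) by (simp add: degree_pderiv)
  ultimately have "pderiv G - pCons 0 (pderiv F) = 0"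
    using roots(2) by (intro zero degree_diff_less) auto
  then have eq: "pderiv G = pCons 0 (pderiv F)" by simp
  \<comment> \<open>\<open>Suc h\<close> is \<open>card C - 1\<close>, the largest degree
    \<open>F\<close> can have. In \<open>G' = t F'\<close> the coefficient at \<open>Suc h\<close>
    is a multiple of that of \<open>G\<close> at \<open>card C\<close>, which vanishes.\<close>
  define h where "h = ?h - 2"
  have h: "?h = Suc (Suc h)" using C(2) by (simp add: h_def)
  have "coeff (pderiv G) (Suc h) = of_nat (Suc h) * coeff F (Suc h)"
    unfolding eq by (simp add: coeff_pderiv)
  moreover have "coeff G (Suc (Suc h)) = 0" using degs(2) h by (intro coeff_eq_0) simp
  ultimately have top: "coeff F (Suc h) = 0" by (simp add: coeff_pderiv del: of_nat_Suc)
  have "degree (pCons 0 F) \<le> Suc h"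
  proof (rule degree_le, intro allI impI)
    fix i assume "Suc h < i"
    then show "coeff (pCons 0 F) i = 0"
      using top degs(1) h by (cases i; cases "i = Suc (Suc h)") (auto intro: coeff_eq_0)
  qed
  then have "G - pCons 0 F = 0"
    using roots(1) degs(2) h by (intro zero degree_diff_less) auto
  then have G: "G = pCons 0 F" by simp
  then have "F = 0" using eq by (simp add: pderiv_pCons)
  with G show ?thesis by simp
qed

lemma leading_trivial:
  fixes C :: "'a::field_char_0 set"
  assumes "finite C" "2 \<le> card C" "\<And>c. c \<in> C \<Longrightarrow> 2 \<le> m c" "d < card C"
  shows "leading m C d \<subseteq> {(0, 0)}"
  using multi_fields_low_degree[OF assms(1-3) _ assms(4)] unfolding leading_def by force

section \<open>Upper estimate of the dimension from the line at infinity\<close>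

lemma dim_le_log_fields_step:
  fixes S :: "('a::field \<times> 'a) set"
  assumes "finite S"
  defines "L \<equiv> leading (\<lambda>c. card {b. (c, b) \<in> S}) (fst ` S)"
  assumes rank0: "\<And>d. d \<le> n \<Longrightarrow> d < e1 \<Longrightarrow> L d \<subseteq> {(0, 0)}"
    and rank1: "\<And>d. d \<le> n \<Longrightarrow> d < e2 \<Longrightarrow> \<exists>v\<in>- {(0, 0)}. \<forall>w\<in>L d. fst v * snd w = fst w * snd v"
    and dim: "vf.dim_le (log_fields S n) a"
  shows "vf.dim_le (log_fields S (Suc n)) (a + (\<Sum>d\<le>n. of_bool (e1 \<le> d) + of_bool (e2 \<le> d)))"
proof -
  let ?F = "\<lambda>d \<theta>. coeff (top_form (Suc n) (fst \<theta>)) d" and ?G = "\<lambda>d \<theta>. coeff (top_form (Suc n) (snd \<theta>)) d"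
  \<comment> \<open>A filtration from \<open>log_fields S n\<close> at \<open>j = 0\<close> to
    \<open>log_fields S (Suc n)\<close> at \<open>j = Suc n\<close>, by the degree of the top forms
    in \<open>t\<close>. Passing from \<open>U j\<close> to \<open>U (Suc j)\<close> costs at most
    the rank of \<open>L j\<close>: 0, 1 or 2 according to the position of \<open>j\<close> relative
    to \<open>e1\<close> and \<open>e2\<close>.\<close>
  define U where "U j = {\<theta> \<in> log_fields S (Suc n). \<forall>d\<ge>j. ?F d \<theta> = 0 \<and> ?G d \<theta> = 0}" for j
  have U0: "U 0 = log_fields S n"
    unfolding U_def log_fields_def tdeg_less_Suc[of n] by (auto simp: poly_eq_iff)
  have U_Suc: "U (Suc n) = log_fields S (Suc n)"
    unfolding U_def by (auto simp: coeff_top_form)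
  have subspace_U: "vf.subspace (U j)" for j
    using subspace_log_fields[of S "Suc n"] unfolding vf.subspace_def U_def by (auto simp: top_form_add top_form_smult)
  have UI: "\<theta> \<in> U j" if "\<theta> \<in> U (Suc j)" "?F j \<theta> = 0" "?G j \<theta> = 0" for \<theta> j
    using that le_eq_less_or_eq[of j] by (auto simp: U_def)
  have U_L: "(?F j \<theta>, ?G j \<theta>) \<in> L j" if "\<theta> \<in> U (Suc j)" for \<theta> j
    unfolding L_def using that \<open>finite S\<close>
    by (intro leading_top_form) (auto simp: U_def)
  have "vf.dim_le (U j) (a + (\<Sum>d<j. of_bool (e1 \<le> d) + of_bool (e2 \<le> d)))" if "j \<le> Suc n" for j
    using that
  proof (induction j)
    case 0
    then show ?case using U0 dim by simp
  next
    case (Suc j)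
    then have j: "j \<le> n" and IH: "vf.dim_le (U j) (a + (\<Sum>d<j. of_bool (e1 \<le> d) + of_bool (e2 \<le> d)))"
      by simp_all
    consider "j < e1" | "e1 \<le> j" "j < e2" | "e1 \<le> j" "e2 \<le> j" by linarith
    then show ?case
    proof cases
      case 1
      then have "U (Suc j) \<subseteq> U j" using rank0[OF j] U_L UI by blast
      then show ?thesis by (rule vf.dim_le_mono[OF IH]) simp
    next
      case 2
      then obtain v where v: "v \<noteq> (0, 0)" "\<And>w. w \<in> L j \<Longrightarrow> fst v * snd w = fst w * snd v"
        using rank1[OF j] by auto
      \<comment> \<open>\<open>L j\<close> lies on the line spanned by \<open>v\<close>, so a
        coordinate in which \<open>v\<close> is nonzero detects all of it.\<close>
      let ?\<phi> = "if fst v = 0 then ?G j else ?F j"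
      have "{\<theta> \<in> U (Suc j). ?\<phi> \<theta> = 0} \<subseteq> U j"
      proof safe
        fix \<theta> assume \<theta>: "\<theta> \<in> U (Suc j)" "?\<phi> \<theta> = 0"
        show "\<theta> \<in> U j"
          using v(1) v(2)[OF U_L[OF \<theta>(1)]] \<theta>(2)
          by (intro UI[OF \<theta>(1)]) (auto simp: prod_eq_iff split: if_splits)
      qed
      then have "vf.dim_le {\<theta> \<in> U (Suc j). ?\<phi> \<theta> = 0} (a + (\<Sum>d<j. of_bool (e1 \<le> d) + of_bool (e2 \<le> d)))"
        by (rule vf.dim_le_mono[OF IH]) simp
      then have "vf.dim_le (U (Suc j)) (Suc (a + (\<Sum>d<j. of_bool (e1 \<le> d) + of_bool (e2 \<le> d))))"
        by (rule vf.dim_le_functional[rotated -1]) (simp_all add: subspace_U top_form_add top_form_smult)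
      then show ?thesis by (rule vf.dim_le_mono) (use 2 in simp_all)
    next
      case 3
      let ?\<phi> = "\<lambda>i::nat. if i = 0 then ?G j else ?F j"
      have "{\<theta> \<in> U (Suc j). \<forall>i<2. ?\<phi> i \<theta> = 0} \<subseteq> U j"
        by (auto intro!: UI simp: less_2_cases_iff)
      then have "vf.dim_le {\<theta> \<in> U (Suc j). \<forall>i<2. ?\<phi> i \<theta> = 0} (a + (\<Sum>d<j. of_bool (e1 \<le> d) + of_bool (e2 \<le> d)))"
        by (rule vf.dim_le_mono[OF IH]) simp
      then have "vf.dim_le (U (Suc j)) (a + (\<Sum>d<j. of_bool (e1 \<le> d) + of_bool (e2 \<le> d)) + 2)"
        by (rule vf.dim_le_functionals[rotated -1]) (simp_all add: subspace_U top_form_add top_form_smult)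
      then show ?thesis by (rule vf.dim_le_mono) (use 3 in simp_all)
    qed
  qed
  from this[of "Suc n"] show ?thesis by (simp add: U_Suc lessThan_Suc_atMost)
qed

lemma sum_sum_of_bool:
  fixes e n :: nat
  assumes "e \<le> n"
  shows "2 * (\<Sum>k<n. \<Sum>d\<le>k. of_bool (e \<le> d)) = (n - e) * (n - e + 1)"
proof -
  have inner: "(\<Sum>d\<le>k. of_bool (e \<le> d)) = Suc k - e" for k
  proof (induction k)
    case 0
    then show ?case by (cases e) simp_all
  next
    case (Suc k)
    then show ?case by (cases "e \<le> Suc k") (simp_all add: Suc_diff_le)
  qed
  show ?thesis unfolding inner using assms
    by (induction n rule: dec_induct) (auto simp: Suc_diff_le algebra_simps)
qed

text \<open>If \<open>2 e1 \<le> N\<close>, bounding \<open>N - e2\<close> by \<open>e1\<close>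
  gives \<open>M \<ge> e1 (N - e1)\<close>, and \<open>x (N - x)\<close> does not decrease from
  \<open>h\<close> to \<open>e1\<close>. Otherwise both exponents exceed \<open>N / 2\<close>, which
  gives \<open>M \<ge> N^2 / 4\<close>, the maximum of \<open>x (N - x)\<close>.\<close>

lemma exponents_arith:
  fixes N h e1 e2 M :: int
  assumes "h \<le> e1" "e1 \<le> e2" "e2 \<le> N" "N \<le> e1 + e2" "2 * h \<le> N" "0 \<le> h"
    and "N * (N + 1) \<le> 2 * M + (N - e1) * (N - e1 + 1) + (N - e2) * (N - e2 + 1)"
  shows "h * (N - h) \<le> M"
proof (cases "2 * e1 \<le> N")
  case True
  have "(N - e2) * (N - e2 + 1) \<le> e1 * (e1 + 1)"
    using assms by (intro mult_mono) auto
  then have "e1 * (N - e1) \<le> M" using assms(7) by (simp add: algebra_simps)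
  moreover have "0 \<le> (e1 - h) * (N - e1 - h)"
    using True assms by (intro mult_nonneg_nonneg) auto
  ultimately show ?thesis by (simp add: algebra_simps)
next
  case False
  have "(N - e2) * (N - e2 + 1) \<le> (N - e1) * (N - e1 + 1)"
    using assms by (intro mult_mono) auto
  moreover have "2 * (N - e1) * (2 * (N - e1) + 2) \<le> (N - 1) * (N - 1 + 2)"
    using False assms by (intro mult_mono) auto
  moreover have "0 \<le> (N - 2 * h) * (N - 2 * h)" by simp
  ultimately show ?thesis using assms(5,6,7) by (simp add: algebra_simps)
qed

lemma sum_card_fibers:
  assumes "finite S"
  shows "(\<Sum>c\<in>fst ` S. card {b. (c, b) \<in> S}) = card S"
proof -
  have "finite {b. (c, b) \<in> S}" for c
    by (rule finite_subset[of _ "snd ` S"]) (use assms in force)+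
  then have "card (SIGMA c:fst ` S. {b. (c, b) \<in> S}) = (\<Sum>c\<in>fst ` S. card {b. (c, b) \<in> S})"
    using assms by simp
  moreover have "(SIGMA c:fst ` S. {b. (c, b) \<in> S}) = S" by force
  ultimately show ?thesis by simp
qed

lemma excess_lower_bound:
  fixes S :: "('a::field_char_0 \<times> 'a) set"
  assumes S: "finite S" and h: "2 \<le> card (fst ` S)"
    and m: "\<And>c. c \<in> fst ` S \<Longrightarrow> 2 \<le> card {b. (c, b) \<in> S}"
  shows "2 * card (fst ` S) \<le> card S"
    and "int (card (fst ` S)) * (int (card S) - card (fst ` S)) \<le> excess S"
proof -
  let ?m = "\<lambda>c. card {b. (c, b) \<in> S}" and ?C = "fst ` S" and ?N = "card S"
  let ?L = "leading ?m ?C"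
  note N = sum_card_fibers[OF S, symmetric]
  have "(\<Sum>c\<in>?C. 2) \<le> (\<Sum>c\<in>?C. ?m c)" by (intro sum_mono m)
  then show Nh: "2 * card ?C \<le> ?N" using N by simp
  \<comment> \<open>The alternative \<open>d = ?N\<close> makes least elements exist and keeps them
    at most \<open>?N\<close>. If it is attained, \<open>?N \<le> e1 + e2\<close> holds
    trivially.\<close>
  define P1 where "P1 d \<longleftrightarrow> d = ?N \<or> (\<exists>v\<in>?L d. v \<noteq> (0, 0))" for d
  define P2 where "P2 d \<longleftrightarrow> d = ?N \<or> (\<exists>v\<in>?L d. \<exists>w\<in>?L d. fst v * snd w \<noteq> fst w * snd v)" for d
  define e1 e2 where "e1 = (LEAST d. P1 d)" and "e2 = (LEAST d. P2 d)"
  have P1: "P1 e1" and P2: "P2 e2"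
    unfolding e1_def e2_def by (rule LeastI[of _ ?N], simp add: P1_def P2_def)+
  have le: "d < e1 \<Longrightarrow> \<not> P1 d" "d < e2 \<Longrightarrow> \<not> P2 d" for d
    unfolding e1_def e2_def by (blast dest: not_less_Least)+
  have "P1 e2" using P2 unfolding P1_def P2_def by force
  then have e12: "e1 \<le> e2" using le(1) not_le by blast
  have e2N: "e2 \<le> ?N" using le(2)[of ?N] by (auto simp: P2_def not_le[symmetric])
  have e1h: "card ?C \<le> e1"
  proof (rule ccontr)
    assume "\<not> card ?C \<le> e1"
    then have "?L e1 \<subseteq> {(0, 0)}" using S h m by (intro leading_trivial) auto
    moreover have "e1 \<noteq> ?N" using Nh \<open>\<not> card ?C \<le> e1\<close> by simp
    ultimately show False using P1 by (auto simp: P1_def)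
  qed
  have Ne: "?N \<le> e1 + e2"
  proof (cases "e2 = ?N \<or> e1 = ?N")
    case False
    then obtain u v w where u: "u \<in> ?L e1" "u \<noteq> (0, 0)"
      and vw: "v \<in> ?L e2" "w \<in> ?L e2" "fst v * snd w \<noteq> fst w * snd v"
      using P1 P2 unfolding P1_def P2_def by blast
    \<comment> \<open>The nonzero \<open>u\<close> cannot be proportional to both of two independent
      vectors, so Saito's criterion applies to \<open>u\<close> with \<open>v\<close> or with
      \<open>w\<close>.\<close>
    have "fst u * snd v \<noteq> fst v * snd u \<or> fst u * snd w \<noteq> fst w * snd u"
    proof (rule ccontr)
      assume "\<not> ?thesis"
      then have *: "fst u * snd v = fst v * snd u" "fst u * snd w = fst w * snd u" by simp_all
      have "fst u * (fst v * snd w) = fst u * (fst w * snd v)" using * by algebra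
      moreover have "snd u * (fst v * snd w) = snd u * (fst w * snd v)" using * by algebra
      ultimately show False using u(2) vw(3) by (auto simp: prod_eq_iff)
    qed
    then show ?thesis
      unfolding N using S u(1) vw(1,2)
        leading_independent[of ?C "fst u" "snd u" ?m e1 "fst v" "snd v" e2]
        leading_independent[of ?C "fst u" "snd u" ?m e1 "fst w" "snd w" e2]
      by auto
  qed auto
  let ?\<delta> = "\<lambda>d. of_bool (e1 \<le> d) + of_bool (e2 \<le> d) :: nat"
  \<comment> \<open>Starting from the zero space at \<open>n = 0\<close>, each degree adds the
    contribution of its top forms.\<close>
  have "vf.dim_le (log_fields S n) (\<Sum>k<n. \<Sum>d\<le>k. ?\<delta> d)" if "n \<le> ?N" for n
    using that
  proof (induction n)
    case 0
    have "log_fields S 0 \<subseteq> {0}" by (auto simp: log_fields_def tdeg_less_0 prod_eq_iff)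
    then show ?case using vf.dim_le_mono[OF vf.dim_le_zero] by simp
  next
    case (Suc n)
    have "\<exists>v\<in>- {(0, 0)}. \<forall>w\<in>?L d. fst v * snd w = fst w * snd v" if "d \<le> n" "d < e2" for d
    proof (cases "?L d \<subseteq> {(0, 0)}")
      case True
      then show ?thesis by (intro bexI[of _ "(1, 1)"]) auto
    next
      case False
      then obtain v where v: "v \<in> ?L d" "v \<noteq> (0, 0)" by blast
      have "\<not> P2 d" by (rule le(2)[OF that(2)])
      then show ?thesis using v unfolding P2_def by blast
    qed
    moreover have "?L d \<subseteq> {(0, 0)}" if "d < e1" for d
      using le(1)[OF that] unfolding P1_def by blast
    ultimately show ?case
      using Suc S dim_le_log_fields_step[of S n e1 e2] by simp
  qed
  \<comment> \<open>The two estimates are now compared at \<open>n = ?N\<close>.\<close>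
  from dim_le_log_fields_empty[OF S order_refl this[OF order_refl]]
  obtain R where R: "vf.dim_le (log_fields {} ?N :: 'a vfield set) ((\<Sum>k<?N. \<Sum>d\<le>k. ?\<delta> d) + R)"
    "2 * int R = 2 * int ?N * ?N - ?N * (?N - 1) + 2 * excess S" by blast
  have "2 * (?N * (?N + 1)) \<le> 2 * (\<Sum>k<?N. \<Sum>d\<le>k. ?\<delta> d) + 2 * R"
    using dim_le_all_fields[OF R(1)] by simp
  also have "2 * (\<Sum>k<?N. \<Sum>d\<le>k. ?\<delta> d) = (?N - e1) * (?N - e1 + 1) + (?N - e2) * (?N - e2 + 1)"
    using sum_sum_of_bool[of e1 ?N] sum_sum_of_bool[of e2 ?N] e12 e2N
    by (simp only: sum.distrib distrib_left)
  finally have *: "int (2 * (?N * (?N + 1))) \<le>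
      int ((?N - e1) * (?N - e1 + 1) + (?N - e2) * (?N - e2 + 1) + 2 * R)"
    by (simp only: of_nat_le_iff)
  have int_diff: "int (?N - e1) = int ?N - int e1" "int (?N - e2) = int ?N - int e2"
    using e12 e2N by simp_all
  from * have "2 * (int ?N * (?N + 1)) \<le>
      (int ?N - e1) * (int ?N - e1 + 1) + (int ?N - e2) * (int ?N - e2 + 1) + 2 * int R"
    unfolding of_nat_add of_nat_mult int_diff by simp
  moreover have "int (?N * (?N - 1)) = int ?N * (int ?N - 1)"
    by (cases "?N") (simp_all add: algebra_simps)
  ultimately have "int ?N * (int ?N + 1) \<le>
      2 * int (excess S) + (int ?N - e1) * (int ?N - e1 + 1) + (int ?N - e2) * (int ?N - e2 + 1)"
    using R(2) by (simp add: algebra_simps)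
  then show "int (card ?C) * (int ?N - card ?C) \<le> excess S"
    using e1h e12 e2N Ne Nh by (intro exponents_arith[of _ e1 e2]) auto
qed

section \<open>Affine charts of the projective plane\<close>

lemma span_singleton_subset_iff: "vec.subspace X \<Longrightarrow> vec.span {z} \<subseteq> X \<longleftrightarrow> z \<in> X"
  by (meson insertI1 insert_subset empty_subsetI subset_iff vec.span_base vec.span_minimal)

lemma proj_point_iff: "proj_point q \<longleftrightarrow> (\<exists>z. z \<noteq> 0 \<and> q = vec.span {z})"
proof
  assume q: "proj_point q"
  then obtain B where B: "B \<subseteq> q" "vec.independent B" "q \<subseteq> vec.span B" "card B = 1"
    unfolding proj_point_def using vec.basis_exists by metis
  then obtain z where "B = {z}" by (auto simp: card_1_singleton_iff)
  then show "\<exists>z. z \<noteq> 0 \<and> q = vec.span {z}"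
    using B q vec.span_minimal[of B q] by (auto simp: proj_point_def intro!: exI[of _ z])
next
  assume "\<exists>z. z \<noteq> 0 \<and> q = vec.span {z}"
  then obtain z where "z \<noteq> 0" "q = vec.span {z}" by auto
  moreover have "vec.dim (vec.span {z}) = card {z}"
    using \<open>z \<noteq> 0\<close> by (intro vec.dim_span_eq_card_independent) simp
  ultimately show "proj_point q" by (simp add: proj_point_def)
qed

lemma span_scale_singleton:
  fixes z :: "'a::field ^ 'n"
  assumes "k \<noteq> 0"
  shows "vec.span {k *s z} = vec.span {z}"
proof -
  have "z = inverse k *s (k *s z)" using assms by simp
  then have "z \<in> vec.span {k *s z}" by (metis insertI1 vec.span_base vec.span_scale)
  moreover have "k *s z \<in> vec.span {z}" by (simp add: vec.span_base vec.span_scale)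
  ultimately show ?thesis
    by (intro equalityI) (simp_all only: span_singleton_subset_iff vec.subspace_span)
qed

lemma proj_lines_Int:
  assumes "proj_line H1" "proj_line H2" "H1 \<noteq> H2" "proj_point q" "q \<subseteq> H1" "q \<subseteq> H2"
  shows "q = H1 \<inter> H2"
proof -
  have sub: "vec.subspace (H1 \<inter> H2)"
    using assms(1,2) by (simp add: proj_line_def vec.subspace_inter)
  have "vec.dim (H1 \<inter> H2) \<noteq> 2"
    using assms(1,2,3) sub vec.subspace_dim_equal[of "H1 \<inter> H2"] unfolding proj_line_def
    by (metis inf_le1 inf_le2 order_refl)
  moreover have "vec.dim (H1 \<inter> H2) \<le> 2"
    using vec.dim_subset[of "H1 \<inter> H2" H1] assms(1) by (simp add: proj_line_def)
  ultimately show ?thesis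
    using assms sub by (intro vec.subspace_dim_equal) (auto simp: proj_point_def)
qed

lemma mem_L2_iff:
  assumes "finite A" "\<forall>H\<in>A. proj_line H"
  shows "q \<in> L2 A \<longleftrightarrow> proj_point q \<and> 2 \<le> card {H \<in> A. q \<subseteq> H}"
proof -
  have fin: "finite {H \<in> A. q \<subseteq> H}" using assms(1) by simp
  have "2 \<le> card {H \<in> A. q \<subseteq> H} \<longleftrightarrow> \<not> card {H \<in> A. q \<subseteq> H} \<le> Suc 0" by auto
  also have "\<dots> \<longleftrightarrow> (\<exists>H1\<in>A. \<exists>H2\<in>A. H1 \<noteq> H2 \<and> q \<subseteq> H1 \<and> q \<subseteq> H2)"
    unfolding card_le_Suc0_iff_eq[OF fin] by blast
  finally have "2 \<le> card {H \<in> A. q \<subseteq> H} \<longleftrightarrow> (\<exists>H1\<in>A. \<exists>H2\<in>A. H1 \<noteq> H2 \<and> q \<subseteq> H1 \<and> q \<subseteq> H2)" .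
  moreover have "H1 \<noteq> H2 \<and> q = H1 \<inter> H2 \<longleftrightarrow> H1 \<noteq> H2 \<and> q \<subseteq> H1 \<and> q \<subseteq> H2"
    if "proj_point q" "H1 \<in> A" "H2 \<in> A" for H1 H2
    using proj_lines_Int[of H1 H2 q] assms(2) that by blast
  ultimately show ?thesis unfolding L2_def by (simp cong: bex_cong conj_cong)
qed

text \<open>A basis of the space, stated through coordinates. In the chart \<open>a = 1\<close> the
  vector \<open>vec_of a b c\<close> has the affine coordinates \<open>x = b\<close> and
  \<open>y = c\<close>.\<close>

locale frame =
  fixes u v w :: "'k::field ^ 3"
  assumes coords_exist: "\<exists>a b c. z = a *s u + b *s v + c *s w"
    and coords_independent: "a *s u + b *s v + c *s w = 0 \<Longrightarrow> a = 0 \<and> b = 0 \<and> c = 0"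
begin

definition vec_of :: "'k \<Rightarrow> 'k \<Rightarrow> 'k \<Rightarrow> 'k ^ 3" where
  "vec_of a b c = a *s u + b *s v + c *s w"

text \<open>The line at infinity is spanned by \<open>v\<close> and \<open>w\<close>; the affine lines are those that miss the
  point \<open>w\<close> on it.\<close>

definition infinity :: "('k ^ 3) set" where
  "infinity = {vec_of 0 b c | b c. True}"

definition affine_line :: "'k \<times> 'k \<Rightarrow> ('k ^ 3) set" where
  "affine_line l = {vec_of a b (a * snd l + b * fst l) | a b. True}"

definition affine_point :: "'k \<times> 'k \<Rightarrow> ('k ^ 3) set" where
  "affine_point p = vec.span {vec_of 1 (fst p) (snd p)}"

definition point_at_infinity :: "'k \<Rightarrow> ('k ^ 3) set" where
  "point_at_infinity c = vec.span {vec_of 0 1 c}"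

lemma vec_of_add: "vec_of a b c + vec_of a' b' c' = vec_of (a + a') (b + b') (c + c')"
  by (simp add: vec_of_def vec.scale_left_distrib algebra_simps)

lemma vec_of_scale: "k *s vec_of a b c = vec_of (k * a) (k * b) (k * c)"
  by (simp add: vec_of_def vec.scale_right_distrib)

lemma vec_of_eq_iff: "vec_of a b c = vec_of a' b' c' \<longleftrightarrow> a = a' \<and> b = b' \<and> c = c'"
proof
  assume "vec_of a b c = vec_of a' b' c'"
  then have "vec_of a b c + (- 1) *s vec_of a' b' c' = 0" by simp
  then have "vec_of (a - a') (b - b') (c - c') = 0" unfolding vec_of_scale vec_of_add by simp
  then show "a = a' \<and> b = b' \<and> c = c'" using coords_independent unfolding vec_of_def by fastforce
qed simp

lemma vec_of_0: "vec_of 0 0 0 = 0"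
  by (simp add: vec_of_def)

lemma vec_of_cases: obtains a b c where "z = vec_of a b c"
  using coords_exist unfolding vec_of_def by blast

lemma mem_affine_line: "vec_of a b c \<in> affine_line l \<longleftrightarrow> c = a * snd l + b * fst l"
  by (auto simp: affine_line_def vec_of_eq_iff)

lemma mem_infinity: "vec_of a b c \<in> infinity \<longleftrightarrow> a = 0"
  by (auto simp: infinity_def vec_of_eq_iff)

lemma subspace_affine_line: "vec.subspace (affine_line l)"
  unfolding vec.subspace_def
proof (intro conjI ballI allI)
  show "0 \<in> affine_line l" unfolding vec_of_0[symmetric] mem_affine_line by simp
  show "x + y \<in> affine_line l" if "x \<in> affine_line l" "y \<in> affine_line l" for x y
    by (rule vec_of_cases[of x], rule vec_of_cases[of y])
      (use that in \<open>simp add: vec_of_add mem_affine_line algebra_simps\<close>)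
  show "k *s x \<in> affine_line l" if "x \<in> affine_line l" for k x
    by (rule vec_of_cases[of x])
      (use that in \<open>simp add: vec_of_scale mem_affine_line algebra_simps\<close>)
qed

lemma subspace_infinity: "vec.subspace infinity"
  unfolding vec.subspace_def
proof (intro conjI ballI allI)
  show "0 \<in> infinity" unfolding vec_of_0[symmetric] mem_infinity by simp
  show "x + y \<in> infinity" if "x \<in> infinity" "y \<in> infinity" for x y
    by (rule vec_of_cases[of x], rule vec_of_cases[of y])
      (use that in \<open>simp add: vec_of_add mem_infinity\<close>)
  show "k *s x \<in> infinity" if "x \<in> infinity" for k x
    by (rule vec_of_cases[of x]) (use that in \<open>simp add: vec_of_scale mem_infinity\<close>)
qed

lemma dim_affine_line: "2 \<le> vec.dim (affine_line l)"
proof -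
  let ?p = "vec_of 1 0 (snd l)" and ?q = "vec_of 0 1 (fst l)"
  have "?p \<notin> vec.span {?q}"
    unfolding vec.span_singleton by (auto simp: vec_of_scale vec_of_eq_iff)
  moreover have "?q \<noteq> 0" unfolding vec_of_0[symmetric] vec_of_eq_iff by simp
  ultimately have "vec.independent {?p, ?q}"
    by (simp add: vec.independent_insert)
  then have "card {?p, ?q} \<le> vec.dim (affine_line l)"
    by (intro vec.independent_card_le_dim) (simp_all add: mem_affine_line)
  moreover have "?p \<noteq> ?q" by (simp add: vec_of_eq_iff)
  ultimately show ?thesis by simp
qed

text \<open>Eliminating the first coordinate between two independent vectors of \<open>H\<close>
  yields a vector at infinity. Its second coordinate is nonzero since \<open>vec_of 0 0 1\<close> is
  not in \<open>H\<close>, so it can be scaled to 1.\<close>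

lemma proj_line_affine:
  assumes H: "proj_line H" "\<not> H \<subseteq> infinity" "vec_of 0 0 1 \<notin> H"
  shows "\<exists>l. H = affine_line l"
proof -
  have sub: "vec.subspace H" and dim: "vec.dim H = 2" using H(1) by (auto simp: proj_line_def)
  obtain a b c where z: "vec_of a b c \<in> H" "a \<noteq> 0"
    using H(2) by (metis mem_infinity subsetI vec_of_cases)
  have "\<not> H \<subseteq> vec.span {vec_of a b c}"
    using vec.dim_le_card[of H "{vec_of a b c}"] dim by auto
  then obtain a' b' c' where z': "vec_of a' b' c' \<in> H" "vec_of a' b' c' \<notin> vec.span {vec_of a b c}"
    by (metis subsetI vec_of_cases)
  let ?B = "a * b' - a' * b" and ?C = "a * c' - a' * c"
  have "a *s vec_of a' b' c' + (- a') *s vec_of a b c \<in> H"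
    by (intro vec.subspace_add vec.subspace_scale sub z z')
  then have BC: "vec_of 0 ?B ?C \<in> H"
    unfolding vec_of_scale vec_of_add by (simp add: algebra_simps)
  have "?B \<noteq> 0"
  proof
    assume B: "?B = 0"
    have "?C = 0"
    proof (rule ccontr)
      assume "?C \<noteq> 0"
      then have "vec_of 0 0 1 = (1 / ?C) *s vec_of 0 ?B ?C"
        unfolding vec_of_scale B by simp
      then show False using H(3) vec.subspace_scale[OF sub BC] by metis
    qed
    then have "vec_of a' b' c' = (a' / a) *s vec_of a b c"
      using B z(2) unfolding vec_of_scale vec_of_eq_iff by (simp add: field_simps)
    then show False using z'(2) unfolding vec.span_singleton by blast
  qed
  have "(1 / ?B) *s vec_of 0 ?B ?C \<in> H" using sub BC by (rule vec.subspace_scale)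
  then have p: "vec_of 0 1 (?C / ?B) \<in> H" unfolding vec_of_scale using \<open>?B \<noteq> 0\<close> by simp
  \<comment> \<open>\<open>?s\<close> is the slope and \<open>?t\<close> the intercept.\<close>
  let ?s = "?C / ?B" and ?t = "c / a - (b / a) * (?C / ?B)"
  have "(1 / a) *s vec_of a b c + (- (b / a)) *s vec_of 0 1 ?s \<in> H"
    by (intro vec.subspace_add vec.subspace_scale sub z p)
  then have q: "vec_of 1 0 ?t \<in> H" unfolding vec_of_scale vec_of_add using z(2) by simp
  have "affine_line (?s, ?t) \<subseteq> H"
  proof
    fix x assume "x \<in> affine_line (?s, ?t)"
    then obtain d e where "x = vec_of d e (d * ?t + e * ?s)" by (auto simp: affine_line_def)
    then have "x = d *s vec_of 1 0 ?t + e *s vec_of 0 1 ?s" unfolding vec_of_scale vec_of_add by simp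
    then show "x \<in> H" using sub p q by (simp add: vec.subspace_add vec.subspace_scale)
  qed
  then have "affine_line (?s, ?t) = H"
    using sub subspace_affine_line dim dim_affine_line by (intro vec.subspace_dim_equal) auto
  then show ?thesis by blast
qed

lemma affine_point_subset_line: "affine_point p \<subseteq> affine_line l \<longleftrightarrow> snd p = fst l * fst p + snd l"
  by (auto simp: affine_point_def span_singleton_subset_iff subspace_affine_line mem_affine_line algebra_simps)

lemma point_at_infinity_subset_line: "point_at_infinity c \<subseteq> affine_line l \<longleftrightarrow> c = fst l"
  by (simp add: point_at_infinity_def span_singleton_subset_iff subspace_affine_line mem_affine_line)

lemma affine_point_not_subset_infinity: "\<not> affine_point p \<subseteq> infinity"
  by (simp add: affine_point_def span_singleton_subset_iff subspace_infinity mem_infinity)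

lemma point_at_infinity_subset_infinity: "point_at_infinity c \<subseteq> infinity"
  by (simp add: point_at_infinity_def span_singleton_subset_iff subspace_infinity mem_infinity)

lemma proj_point_affine_point: "proj_point (affine_point p)"
  unfolding affine_point_def proj_point_iff using vec_of_eq_iff vec_of_0 zero_neq_one by metis

lemma proj_point_at_infinity: "proj_point (point_at_infinity c)"
  unfolding point_at_infinity_def proj_point_iff using vec_of_eq_iff vec_of_0 zero_neq_one by metis

lemma inj_affine_point: "inj affine_point"
proof (rule injI)
  fix p p' assume "affine_point p = affine_point p'"
  then have "vec_of 1 (fst p) (snd p) \<in> vec.span {vec_of 1 (fst p') (snd p')}"
    unfolding affine_point_def by (metis insertI1 vec.span_base)
  then show "p = p'" unfolding vec.span_singleton by (auto simp: vec_of_scale vec_of_eq_iff prod_eq_iff)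
qed

lemma inj_point_at_infinity: "inj point_at_infinity"
proof (rule injI)
  fix c c' assume "point_at_infinity c = point_at_infinity c'"
  then have "vec_of 0 1 c \<in> vec.span {vec_of 0 1 c'}"
    unfolding point_at_infinity_def by (metis insertI1 vec.span_base)
  then show "c = c'" unfolding vec.span_singleton by (auto simp: vec_of_scale vec_of_eq_iff)
qed

lemma inj_affine_line: "inj affine_line"
proof (rule injI)
  fix l l' assume eq: "affine_line l = affine_line l'"
  have "vec_of 1 0 (snd l) \<in> affine_line l" "vec_of 0 1 (fst l) \<in> affine_line l"
    by (simp_all add: mem_affine_line)
  then show "l = l'" unfolding eq by (auto simp: mem_affine_line prod_eq_iff)
qed

lemma proj_point_cases:
  assumes "proj_point q"
  obtains p where "q = affine_point p" | c where "q = point_at_infinity c" | "q = vec.span {vec_of 0 0 1}"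
proof -
  obtain z where z: "z \<noteq> 0" "q = vec.span {z}" using assms by (auto simp: proj_point_iff)
  obtain a b c where abc: "z = vec_of a b c" by (rule vec_of_cases)
  consider "a \<noteq> 0" | "a = 0" "b \<noteq> 0" | "a = 0" "b = 0" "c \<noteq> 0"
    using z(1) abc vec_of_0 by auto
  then show thesis
  proof cases
    case 1
    then have "vec_of 1 (b / a) (c / a) = (1 / a) *s z" by (simp add: abc vec_of_scale)
    then have "q = affine_point (b / a, c / a)"
      using 1 z(2) span_scale_singleton[of "1 / a" z] by (simp add: affine_point_def)
    then show thesis by (rule that(1))
  next
    case 2
    then have "vec_of 0 1 (c / b) = (1 / b) *s z" by (simp add: abc vec_of_scale)
    then have "q = point_at_infinity (c / b)"
      using 2 z(2) span_scale_singleton[of "1 / b" z] by (simp add: point_at_infinity_def)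
    then show thesis by (rule that(2))
  next
    case 3
    then have "vec_of 0 0 1 = (1 / c) *s z" by (simp add: abc vec_of_scale)
    then have "q = vec.span {vec_of 0 0 1}"
      using 3 z(2) span_scale_singleton[of "1 / c" z] by simp
    then show thesis by (rule that(3))
  qed
qed

end

text \<open>The point \<open>w\<close> of \<open>H\<close> has to avoid all other lines so that
  these become graphs over \<open>x\<close>. The vectors \<open>w0 + s v\<close> run along
  \<open>H\<close>, each other line contains at most one of them, and a field of characteristic zero
  is infinite.\<close>

lemma exists_frame:
  fixes A :: "('k::field_char_0 ^ 3) set set"
  assumes "finite A" "\<forall>H\<in>A. proj_line H" "H \<in> A"
  shows "\<exists>u v w. frame u v w \<and> H = frame.infinity u v w \<and> (\<forall>H'\<in>A. w \<in> H' \<longrightarrow> H' = H)"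
proof -
  have H: "vec.subspace H" "vec.dim H = 2" using assms by (auto simp: proj_line_def)
  obtain B where B: "B \<subseteq> H" "vec.independent B" "H \<subseteq> vec.span B" "card B = 2"
    using vec.basis_exists[of H] H(2) by metis
  then obtain v w0 where vw0: "B = {v, w0}" "v \<noteq> w0" by (auto simp: card_2_iff)
  have span_H: "vec.span {v, w0} = H" using B H(1) vw0 vec.span_minimal by blast
  have "\<exists>s. \<forall>H'\<in>A. w0 + s *s v \<in> H' \<longrightarrow> H' = H"
  proof -
    have "finite {s. w0 + s *s v \<in> H'}" if H': "H' \<in> A" "H' \<noteq> H" for H'
    proof -
      have sub: "vec.subspace H'" and dim: "vec.dim H' = 2"
        using H'(1) assms(2) by (auto simp: proj_line_def)
      \<comment> \<open>Two parameters in the same \<open>H'\<close> would put \<open>v\<close> and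
        then \<open>w0\<close> into \<open>H'\<close>, forcing \<open>H = H'\<close>.\<close>
      have "s = t" if "w0 + s *s v \<in> H'" "w0 + t *s v \<in> H'" for s t
      proof (rule ccontr)
        assume "s \<noteq> t"
        have "(w0 + s *s v) - (w0 + t *s v) \<in> H'" using sub that by (rule vec.subspace_diff)
        then have "(s - t) *s v \<in> H'" by (simp add: vec.scale_left_diff_distrib)
        then have "(1 / (s - t)) *s ((s - t) *s v) \<in> H'" by (rule vec.subspace_scale[OF sub])
        then have "v \<in> H'" using \<open>s \<noteq> t\<close> by simp
        then have "(w0 + s *s v) - s *s v \<in> H'"
          using sub that(1) by (intro vec.subspace_diff vec.subspace_scale)
        then have "w0 \<in> H'" by simp
        with \<open>v \<in> H'\<close> have "H \<subseteq> H'" unfolding span_H[symmetric] using sub by (intro vec.span_minimal) auto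
        then have "H = H'" using sub dim H by (intro vec.subspace_dim_equal) auto
        then show False using H'(2) by simp
      qed
      then have "\<exists>t. {s. w0 + s *s v \<in> H'} \<subseteq> {t}"
        by (cases "\<exists>t. w0 + t *s v \<in> H'") blast+
      then show ?thesis using finite_subset by blast
    qed
    then have "finite (\<Union>H'\<in>A - {H}. {s. w0 + s *s v \<in> H'})" using assms(1) by auto
    then obtain s where "s \<notin> (\<Union>H'\<in>A - {H}. {s. w0 + s *s v \<in> H'})"
      using ex_new_if_finite infinite_UNIV_char_0 by blast
    then show ?thesis by blast
  qed
  then obtain s where s: "\<And>H'. H' \<in> A \<Longrightarrow> w0 + s *s v \<in> H' \<Longrightarrow> H' = H" by blast
  define w where "w = w0 + s *s v"
  have "H \<noteq> UNIV" using H(2) by (auto simp: vec.dim_UNIV vec_dim_card card_cart_basis)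
  then obtain u where u: "u \<notin> H" by blast
  have v: "v \<in> H" and w: "w \<in> H"
    using B vw0 H(1) by (auto simp: w_def intro: vec.subspace_add vec.subspace_scale)
  have "B = insert w0 {v}" using vw0(1) by blast
  then have "w0 \<notin> vec.span {v}" "v \<noteq> 0"
    using B(2) vw0(2) by (simp_all add: vec.independent_insert)
  then have indep_vw: "b = 0 \<and> c = 0" if "b *s v + c *s w = 0" for b c
  proof -
    have "c = 0"
    proof (rule ccontr)
      assume "c \<noteq> 0"
      have "c *s w0 = (- (b + c * s)) *s v"
        using that by (simp add: w_def vec.scale_left_distrib vec.scale_right_distrib eq_neg_iff_add_eq_0 algebra_simps)
      then have "w0 = (- (b + c * s) / c) *s v"
        using \<open>c \<noteq> 0\<close> by (metis divide_inverse mult.commute vec.scale_scale left_inverse vec.scale_one)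
      then show False using \<open>w0 \<notin> vec.span {v}\<close> by (auto simp: vec.span_singleton)
    qed
    then show ?thesis using that \<open>v \<noteq> 0\<close> by simp
  qed
  have indep: "a = 0 \<and> b = 0 \<and> c = 0" if *: "a *s u + b *s v + c *s w = 0" for a b c
  proof -
    have "a = 0"
    proof (rule ccontr)
      assume "a \<noteq> 0"
      have "a *s u = - (b *s v + c *s w)" by (rule eq_neg_iff_add_eq_0[THEN iffD2]) (use * in \<open>simp add: add.assoc\<close>)
      also have "\<dots> \<in> H"
        using H(1) v w by (intro vec.subspace_neg vec.subspace_add vec.subspace_scale)
      finally have "(1 / a) *s (a *s u) \<in> H" using H(1) by (rule vec.subspace_scale[rotated])
      then show False using u \<open>a \<noteq> 0\<close> by simp
    qed
    then show ?thesis using * indep_vw by simp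
  qed
  have span_vw: "vec.span {v, w} = H"
  proof
    show "vec.span {v, w} \<subseteq> H" using v w H(1) by (intro vec.span_minimal) auto
    have "w - s *s v \<in> vec.span {v, w}"
      by (intro vec.span_diff vec.span_scale vec.span_base) auto
    then have "w0 \<in> vec.span {v, w}" by (simp add: w_def)
    then show "H \<subseteq> vec.span {v, w}"
      unfolding span_H[symmetric] by (intro vec.span_minimal) (auto intro: vec.span_base)
  qed
  have coords_H: "\<exists>b c. z = b *s v + c *s w" if z: "z \<in> H" for z
  proof -
    obtain b where "z - b *s v \<in> vec.span {w}"
      using z vec.span_insert[of v "{w}"] unfolding span_vw by blast
    then obtain c where "z - b *s v = c *s w" by (auto simp: vec.span_singleton)
    then have "z = b *s v + c *s w" by (simp add: diff_eq_eq add.commute)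
    then show ?thesis by blast
  qed
  have "\<exists>a b c. z = a *s u + b *s v + c *s w" for z
  proof -
    have span_B: "vec.span B = H" using vw0(1) span_H by simp
    have "u \<notin> B" using B(1) u by blast
    moreover from this have "vec.independent (insert u B)"
      using B(2) u by (simp add: vec.independent_insert span_B)
    moreover have "finite B" using vw0 by simp
    ultimately have "card (insert u B) = 3" using B(4) by simp
    then have "UNIV \<subseteq> vec.span (insert u B)"
      using \<open>vec.independent (insert u B)\<close>
      by (intro vec.card_ge_dim_independent) (auto simp: vec.dim_UNIV vec_dim_card card_cart_basis)
    then have "z \<in> vec.span (insert u B)" by blast
    then obtain a where "z - a *s u \<in> H" using vec.span_insert[of u B] unfolding span_B by blast
    then obtain b c where "z - a *s u = b *s v + c *s w" using coords_H by blast
    then have "z = a *s u + b *s v + c *s w" by (simp add: diff_eq_eq ac_simps)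
    then show ?thesis by blast
  qed
  then have frame: "frame u v w" using indep by (rule frame.intro)
  have "H = frame.infinity u v w"
  proof
    show "H \<subseteq> frame.infinity u v w"
      unfolding frame.infinity_def[OF frame] frame.vec_of_def[OF frame] using coords_H by auto
    have "0 *s u + b *s v + c *s w \<in> H" for b c
      using v w H(1) by (simp add: vec.subspace_add vec.subspace_scale)
    then show "frame.infinity u v w \<subseteq> H"
      unfolding frame.infinity_def[OF frame] frame.vec_of_def[OF frame] by blast
  qed
  then show ?thesis using frame s unfolding w_def by blast
qed

section \<open>Multiplicities of an arrangement read off in a chart\<close>

context frame begin

context
  fixes S :: "('k \<times> 'k) set" and A :: "('k ^ 3) set set"
  assumes S: "finite S" and A: "A = insert infinity (affine_line ` S)" and lines: "\<forall>H\<in>A. proj_line H"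
begin

lemma infinity_notin: "infinity \<notin> affine_line ` S"
  using mem_infinity[of 0 0 1] mem_affine_line[of 0 0 1] by auto

lemma finite_arrangement: "finite A"
  unfolding A using S by simp

lemma card_arrangement: "card A = Suc (card S)"
  unfolding A using S infinity_notin inj_affine_line
  by (simp add: card_image inj_on_subset)

lemma card_lines_affine_point: "card {H \<in> A. affine_point p \<subseteq> H} = card (through S p)"
proof -
  have "{H \<in> A. affine_point p \<subseteq> H} = affine_line ` through S p"
    unfolding A through_def by (auto simp: affine_point_not_subset_infinity affine_point_subset_line
        intro!: affine_point_subset_line[THEN iffD2])
  then show ?thesis using inj_affine_line by (simp add: card_image inj_on_subset)
qed

lemma card_lines_point_at_infinity:
  "card {H \<in> A. point_at_infinity c \<subseteq> H} = Suc (card {b. (c, b) \<in> S})"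
proof -
  have "{H \<in> A. point_at_infinity c \<subseteq> H} = insert infinity (affine_line ` Pair c ` {b. (c, b) \<in> S})"
    unfolding A by (auto simp: point_at_infinity_subset_line
        intro!: point_at_infinity_subset_line[THEN iffD2] point_at_infinity_subset_infinity)
  moreover have "infinity \<notin> affine_line ` Pair c ` {b. (c, b) \<in> S}" using infinity_notin by auto
  moreover have "finite {b. (c, b) \<in> S}"
    by (rule finite_subset[of _ "snd ` S"]) (use S in force)+
  moreover have "card (affine_line ` Pair c ` {b. (c, b) \<in> S}) = card {b. (c, b) \<in> S}"
    unfolding image_image by (rule card_image) (auto intro!: inj_onI dest: injD[OF inj_affine_line])
  ultimately show ?thesis by simp
qed

lemma affine_point_neq_point_at_infinity: "affine_point p \<noteq> point_at_infinity c"
  using affine_point_not_subset_infinity point_at_infinity_subset_infinity by metis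

text \<open>At infinity one affine line of the given slope suffices, because the line at infinity is
  itself in \<open>A\<close>. The remaining point, spanned by \<open>vec_of 0 0 1\<close>, lies on
  no affine line.\<close>

lemma L2_arrangement:
  "L2 A = affine_point ` {p. 2 \<le> card (through S p)} \<union> point_at_infinity ` (fst ` S)"
proof (rule set_eqI)
  fix q
  have fib: "1 \<le> card {b. (c, b) \<in> S} \<longleftrightarrow> c \<in> fst ` S" for c
  proof -
    have "finite {b. (c, b) \<in> S}"
      by (rule finite_subset[of _ "snd ` S"]) (use S in force)+
    then show ?thesis by (force simp: Suc_le_eq card_gt_0_iff)
  qed
  show "q \<in> L2 A \<longleftrightarrow> q \<in> affine_point ` {p. 2 \<le> card (through S p)} \<union> point_at_infinity ` (fst ` S)"
  proof (cases "proj_point q")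
    case True
    then show ?thesis
    proof (cases rule: proj_point_cases)
      case (1 p)
      then show ?thesis
        using True
        by (auto simp: affine_point_neq_point_at_infinity inj_image_mem_iff[OF inj_affine_point] mem_L2_iff[OF finite_arrangement lines] card_lines_affine_point)
    next
      case (2 c)
      then show ?thesis
        using True fib[of c]
        by (auto simp: affine_point_neq_point_at_infinity[symmetric] inj_image_mem_iff[OF inj_point_at_infinity] mem_L2_iff[OF finite_arrangement lines] card_lines_point_at_infinity)
    next
      case 3
      have "\<not> q \<subseteq> affine_line l" for l
        unfolding 3 by (simp add: span_singleton_subset_iff subspace_affine_line mem_affine_line)
      then have sub: "{H \<in> A. q \<subseteq> H} \<subseteq> {infinity}" unfolding A by auto
      then have "card {H \<in> A. q \<subseteq> H} \<le> 1"
        using card_mono[OF _ sub] by simp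
      moreover have "q \<noteq> affine_point p" for p
        using affine_point_not_subset_infinity
        unfolding 3 by (metis mem_infinity span_singleton_subset_iff subspace_infinity)
      moreover have "q \<noteq> point_at_infinity c" for c
        using \<open>\<not> q \<subseteq> affine_line (c, 0)\<close> point_at_infinity_subset_line[of c "(c, 0)"] by auto
      ultimately show ?thesis by (auto simp: mem_L2_iff[OF finite_arrangement lines])
    qed
  next
    case False
    then show ?thesis
      using proj_point_affine_point proj_point_at_infinity by (auto simp: L2_def)
  qed
qed

lemma finite_L2: "finite (L2 A)"
  unfolding L2_arrangement using S finite_multiple_points by auto

lemma restriction_infinity: "restriction A infinity = point_at_infinity ` (fst ` S)"
  unfolding restriction_def L2_arrangement
  using affine_point_not_subset_infinity point_at_infinity_subset_infinity by auto

lemma card_restriction_infinity: "card (restriction A infinity) = card (fst ` S)"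
  unfolding restriction_infinity using inj_point_at_infinity by (simp add: card_image inj_on_subset)

text \<open>At infinity \<open>mu\<close> is the number of affine lines of the given slope, as the
  line at infinity accounts for the subtracted 1. Summed over all slopes this is
  \<open>card S\<close>.\<close>

lemma sum_mu: "(\<Sum>q\<in>L2 A. mu A q) = int (excess S) + int (card S)"
proof -
  have fin: "finite {p. 2 \<le> card (through S p)}" using S by (rule finite_multiple_points)
  have "(\<Sum>q\<in>L2 A. mu A q) = (\<Sum>q\<in>affine_point ` {p. 2 \<le> card (through S p)}. mu A q)
      + (\<Sum>q\<in>point_at_infinity ` fst ` S. mu A q)"
    unfolding L2_arrangement using fin S
    by (intro sum.union_disjoint) (auto simp: affine_point_neq_point_at_infinity)
  also have "(\<Sum>q\<in>affine_point ` {p. 2 \<le> card (through S p)}. mu A q) = int (excess S)"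
    unfolding excess_def of_nat_sum
    by (subst sum.reindex[OF inj_on_subset[OF inj_affine_point subset_UNIV]])
      (auto intro!: sum.cong simp: mu_def card_lines_affine_point)
  also have "(\<Sum>q\<in>point_at_infinity ` fst ` S. mu A q) = (\<Sum>c\<in>fst ` S. int (card {b. (c, b) \<in> S}))"
    by (subst sum.reindex[OF inj_on_subset[OF inj_point_at_infinity subset_UNIV]])
      (auto intro!: sum.cong simp: mu_def card_lines_point_at_infinity)
  also have "\<dots> = int (card S)"
    using sum_card_fibers[OF S] by (simp flip: of_nat_sum)
  finally show ?thesis .
qed

end

end

section \<open>Divisional freeness against the excess bound\<close>

theorem theorem1p6:
  fixes A :: "('k::field_char_0 ^ 3) set set"
  assumes "line_arrangement A"
    and "divisionally_free A"
  shows "n2 A > 0"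
proof (rule ccontr)
  assume "\<not> n2 A > 0"
  have fin: "finite A" and lines: "\<forall>H\<in>A. proj_line H"
    and noncentral: "\<And>p. proj_point p \<Longrightarrow> \<exists>H\<in>A. \<not> p \<subseteq> H"
    using assms(1) by (auto simp: line_arrangement_def)
  obtain H where H: "H \<in> A" and root: "poly (chi0 A) (int (card (restriction A H)) - 1) = 0"
    using assms(2) by (auto simp: divisionally_free_def)
  obtain u v w where frame: "frame u v w" and H_eq: "H = frame.infinity u v w"
    and w: "\<And>H'. H' \<in> A \<Longrightarrow> w \<in> H' \<Longrightarrow> H' = H"
    using exists_frame[OF fin lines H] by blast
  interpret frame u v w by (rule frame)
  have w_eq: "vec_of 0 0 1 = w" by (simp add: vec_of_def)
  define S where "S = {l. affine_line l \<in> A}"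
  have "H' \<in> insert infinity (affine_line ` S)" if H': "H' \<in> A" for H'
  proof (cases "H' = H")
    case False
    have "\<not> H' \<subseteq> infinity"
      using False H' H lines vec.subspace_dim_equal[of H' H]
      by (auto simp: H_eq[symmetric] proj_line_def)
    then obtain l where "H' = affine_line l"
      using proj_line_affine[of H'] lines H' w False w_eq by metis
    then show ?thesis using H' by (auto simp: S_def)
  qed (simp add: H_eq)
  then have A: "A = insert infinity (affine_line ` S)"
    using H by (auto simp: S_def H_eq)
  have "finite (affine_line ` S)" by (rule finite_subset[OF _ fin]) (auto simp: S_def)
  then have S: "finite S"
    by (rule finite_imageD) (rule inj_on_subset[OF inj_affine_line subset_UNIV])
  let ?h = "card (fst ` S)" and ?N = "card S"
  \<comment> \<open>If all slopes were \<open>c\<close>, every line of \<open>A\<close> would pass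
    through the point at infinity of slope \<open>c\<close>. This also excludes empty
    \<open>S\<close>.\<close>
  have no_pencil: "\<not> fst ` S \<subseteq> {c}" for c
  proof
    assume c: "fst ` S \<subseteq> {c}"
    have "point_at_infinity c \<subseteq> H'" if H': "H' \<in> A" for H'
    proof -
      consider "H' = infinity" | l where "l \<in> S" "H' = affine_line l" using H' unfolding A by blast
      then show ?thesis
      proof cases
        case (2 l)
        then have "c = fst l" using c by blast
        then show ?thesis unfolding 2(2) point_at_infinity_subset_line .
      qed (simp add: point_at_infinity_subset_infinity)
    qed
    then show False using noncentral[OF proj_point_at_infinity] by blast
  qed
  from no_pencil[of 0] obtain c where "c \<in> fst ` S" by auto
  moreover from no_pencil[of c] obtain d where "d \<in> fst ` S" "c \<noteq> d" by auto
  ultimately have h: "2 \<le> ?h"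
    using S card_mono[of "fst ` S" "{c, d}"] by simp
  have "{q \<in> L2 A. mu A q = 1} = {}"
    using \<open>\<not> n2 A > 0\<close> finite_L2[OF S A lines] by (simp add: n2_def)
  then have no_double: "mu A q \<noteq> 1" if "q \<in> L2 A" for q using that by blast
  have fibers: "2 \<le> card {b. (c, b) \<in> S}" if "c \<in> fst ` S" for c
  proof -
    have "point_at_infinity c \<in> L2 A" using that unfolding L2_arrangement[OF S A lines] by blast
    \<comment> \<open>\<open>mu\<close> at this point is the number of lines of slope
      \<open>c\<close>, which is at least 1 and, without double points, different from 1.\<close>
    then have "2 \<le> Suc (card {b. (c, b) \<in> S})" "card {b. (c, b) \<in> S} \<noteq> 1"
      using no_double[of "point_at_infinity c"] mem_L2_iff[OF fin lines]
      by (auto simp: mu_def card_lines_point_at_infinity[OF S A lines])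
    then show ?thesis by simp
  qed
  have N: "2 * ?h \<le> ?N" and bound: "int ?h * (int ?N - ?h) \<le> excess S"
    using excess_lower_bound[OF S h fibers] by blast+
  \<comment> \<open>This is \<open>chi0 A\<close> evaluated at \<open>?h - 1\<close>; since
    \<open>card A = ?N + 1\<close>, its constant term reduces to the excess.\<close>
  have "int (excess S) + (int ?h - 1) * (int ?h - 1 - ?N) = 0"
    using root unfolding H_eq card_restriction_infinity[OF S A lines] chi0_def
      sum_mu[OF S A lines] card_arrangement[OF S A lines] by (simp add: algebra_simps)
  \<comment> \<open>The lower bound exceeds the value forced by the root:
    \<open>h (N - h) - (h - 1) (N + 1 - h) = N + 1 - 2 h\<close>, which is positive as
    \<open>2 h \<le> N\<close>.\<close>
  then show False using bound N by (simp add: algebra_simps)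
qed

end
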